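(* Let $\{X_t\}_{t\in\mathbb{Z}}$ be a real-valued stochastic process on a probability space $(\Omega,\mathcal{A},P)$, let $t\in\mathbb{Z}$, $k\ge 1$ and $r_1,r_2\ge 0$ be integers, and suppose that the conditional density $f_{\underline{X}_{t+k+r_2}^{t+k}|\underline{X}_t^{t-r_1}}$ of $\underline{X}_{t+k+r_2}^{t+k}$ given $\underline{X}_t^{t-r_1}$ exists. For $\underline{\eta}=(\eta_0,\ldots,\eta_{r_1})\in(\mathbb{R}^+)^{r_1+1}$ define $$\mathcal{E}=\{(\nu_0,\ldots,\nu_{r_1}) : |\nu_j|\le\eta_j \text{ for all } j\},\qquad E=\{\omega : \underline{X}_t^{t-r_1}(\omega)\in\mathcal{E}\}.$$ Then for all $r_1,r_2\ge0$ and all $\underline{\eta}$: (1) $$\sup_{H\in\mathcal{F}_t^{t-r_1},\,G\in\mathcal{F}_{t+k+r_2}^{t+k}}|P(G\cap H)-P(G)P(H)|\le 2\sup_{\underline{x}\in\mathcal{E}}\int_{\mathbb{R}^{r_2+1}}\bigl|f_{\underline{X}_{t+k+r_2}^{t+k}|\underline{X}_t^{t-r_1}}(\underline{y}|\underline{x})-f_{\underline{X}_{t+k+r_2}^{t+k}|\underline{X}_t^{t-r_1}}(\underline{y}|0)\bigr|\,d\underline{y}+4P(E^c);$$ (2) $$\sup_{\{H_j\}\subset\mathcal{F}_t^{t-r_1},\,\{G_i\}\subset\mathcal{F}_{t+k+r_2}^{t+k}}\sum_{i,j}|P(G_i\cap H_j)-P(G_i)P(H_j)|\le 2\int_{\mathbb{R}^{r_2+1}}\sup_{\underline{x}\in\mathcal{E}}\bigl|f_{\underline{X}_{t+k+r_2}^{t+k}|\underline{X}_t^{t-r_1}}(\underline{y}|\underline{x})-f_{\underline{X}_{t+k+r_2}^{t+k}|\underline{X}_t^{t-r_1}}(\underline{y}|0)\bigr|\,d\underline{y}+4P(E^c),$$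 where the supremum is over finite partitions $\{G_i\}$ and $\{H_j\}$ of $\Omega$ into sets of the indicated $\sigma$-algebras. Moreover, let $\underline{W}=\underline{W}_{t+k-1}^{t+1}=(W_{t+k-1},\ldots,W_{t+1})$ be a random vector, with density $f_{\underline{W}}$, that is independent of $\underline{X}_t^{t-r_1}$. Let $f_{0,k,t}(y_0|\underline{w},\underline{x})$ denote the conditional density of $X_{t+k}$ given $(\underline{W}_{t+k-1}^{t+1},\underline{X}_t^{t-r_1})=(\underline{w},\underline{x})$ and, for $s\ge1$, let $f_{s,k,t}(y_s|\underline{y}_{s-1},\underline{w},\underline{x})$ denote the conditional density of $X_{t+k+s}$ given $(\underline{X}_{t+k+s-1}^{t+k},\underline{W}_{t+k-1}^{t+1},\underline{X}_t^{t-r_1})=(\underline{y}_{s-1},\underline{w},\underline{x})$, where $\underline{x}=(x_0,\ldots,x_{-r_1})$ and $\underline{w}=(w_{k-1},\ldots,w_1)$. Put $\mathcal{D}_{0,k,t}(y_0|\underline{y}_{-1},\underline{w},\underline{x})=|f_{0,k,t}(y_0|\underline{w},\underline{x})-f_{0,k,t}(y_0|\underline{w},0)|$ and, for $s\ge1$, $\mathcal{D}_{s,k,t}(y_s|\underline{y}_{s-1},\underline{w},\underline{x})=|f_{s,k,t}(y_s|\underline{y}_{s-1},\underline{w},\underline{x})-f_{s,k,t}(y_s|\underline{y}_{s-1},\underline{w},0)|$. Then: (3) $$\sup_{H\in\mathcal{F}_t^{t-r_1},\,G\in\mathcal{F}_{t+k+r_2}^{t+k}}|P(G\cap H)-P(G)P(H)|\le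 2\sum_{s=0}^{r_2}\sup_{\underline{x}\in\mathcal{E}}\mathbb{E}_{\underline{W}}\Bigl(\sup_{\underline{y}_{s-1}\in\mathbb{R}^s}\int_{\mathbb{R}}\mathcal{D}_{s,k,t}(y_s|\underline{y}_{s-1},\underline{W},\underline{x})\,dy_s\Bigr)+4P(E^c);$$ (4) $$\sup_{\{H_j\}\subset\mathcal{F}_t^{t-r_1},\,\{G_i\}\subset\mathcal{F}_{t+k+r_2}^{t+k}}\sum_{i,j}|P(G_i\cap H_j)-P(G_i)P(H_j)|\le 2\sum_{s=0}^{r_2}\mathbb{E}_{\underline{W}}\Bigl(\sup_{\underline{y}_{s-1}\in\mathbb{R}^s}\int_{\mathbb{R}}\sup_{\underline{x}\in\mathcal{E}}\mathcal{D}_{s,k,t}(y_s|\underline{y}_{s-1},\underline{W},\underline{x})\,dy_s\Bigr)+4P(E^c),$$ the supremum again being over finite partitions $\{G_i\}$, $\{H_j\}$ of $\Omega$.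
   Context: Notation: for integers $b\le a$, $\underline{X}_a^{b}=(X_a,X_{a-1},\ldots,X_b)$; thus $\underline{X}_t^{t-r_1}=(X_t,\ldots,X_{t-r_1})$ and $\underline{X}_{t+k+r_2}^{t+k}=(X_{t+k+r_2},\ldots,X_{t+k})$. $\mathcal{F}_t^{t-r_1}=\sigma(X_t,\ldots,X_{t-r_1})$ and $\mathcal{F}_{t+k+r_2}^{t+k}=\sigma(X_{t+k},\ldots,X_{t+k+r_2})$. $\underline{y}_s=(y_s,\ldots,y_0)$, and for $s=0$ the argument $\underline{y}_{s-1}=\underline{y}_{-1}$ is empty (so the supremum over it is vacuous). A conditioning argument $0$ in place of $\underline{x}$ denotes the zero vector. $\mathbb{E}_{\underline{W}}(g(\underline{W}))=\int g(\underline{w})f_{\underline{W}}(\underline{w})\,d\underline{w}$. $E^c$ is the complement of $E$. Conditional densities are with respect to Lebesgue measure. *)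

theory Defs
  imports "HOL-Probability.Probability"
begin

text \<open>
  Lebesgue measure on the space of real vectors with finite index set \<open>I\<close>.  The vectors are the
  extensional functions on \<open>I\<close>; for \<open>I = {}\<close> this is the unit mass on the one-point space, which
  plays the role of the zero-dimensional space.
\<close>
abbreviation lborel_vec :: "nat set \<Rightarrow> (nat \<Rightarrow> real) measure" where
  "lborel_vec I \<equiv> Pi\<^sub>M I (\<lambda>_. lborel)"

text \<open>\<open>(Z\<^sub>t, Z\<^sub>t\<^sub>-\<^sub>1, \<dots>, Z\<^sub>t\<^sub>-\<^sub>r)\<close>, whose \<open>j\<close>-th component (\<open>j = 0, \<dots>, r\<close>) is \<open>Z\<^sub>t\<^sub>-\<^sub>j\<close>.\<close>
definition past_vec :: "(int \<Rightarrow> 'a \<Rightarrow> real) \<Rightarrow> int \<Rightarrow> nat \<Rightarrow> 'a \<Rightarrow> nat \<Rightarrow> real" where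
  "past_vec Z t r \<omega> = (\<lambda>j\<in>{..r}. Z (t - int j) \<omega>)"

text \<open>The vector whose \<open>i\<close>-th component (\<open>i \<in> I\<close>) is \<open>Z\<^sub>t\<^sub>+\<^sub>i\<close>.\<close>
definition fut_vec :: "(int \<Rightarrow> 'a \<Rightarrow> real) \<Rightarrow> int \<Rightarrow> nat set \<Rightarrow> 'a \<Rightarrow> nat \<Rightarrow> real" where
  "fut_vec Z t I \<omega> = (\<lambda>i\<in>I. Z (t + int i) \<omega>)"

abbreviation zero_vec :: "nat \<Rightarrow> nat \<Rightarrow> real" where
  "zero_vec r \<equiv> (\<lambda>j\<in>{..r}. 0)"

definition eta_box :: "nat \<Rightarrow> (nat \<Rightarrow> real) \<Rightarrow> (nat \<Rightarrow> real) set" where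
  "eta_box r \<eta> = {\<nu> \<in> {..r} \<rightarrow>\<^sub>E UNIV. \<forall>j\<le>r. \<bar>\<nu> j\<bar> \<le> \<eta> j}"

text \<open>
  \<open>f y z\<close> is (a version of) the conditional density \<open>f(y | z)\<close>, with respect to the measure \<open>N\<close>,
  of \<open>Y\<close> given \<open>Z = z\<close>.  Versions are regular: \<open>f(\<cdot> | z)\<close> is a probability density for
  every \<open>z\<close>, not merely for almost every \<open>z\<close> under the law of \<open>Z\<close>; the bounds
  below evaluate such densities at the single point \<open>0\<close>, which may well be a null set.
\<close>
definition cond_density ::
  "'a measure \<Rightarrow> 'b measure \<Rightarrow> ('a \<Rightarrow> 'b) \<Rightarrow> 'c measure \<Rightarrow> ('a \<Rightarrow> 'c) \<Rightarrow> ('b \<Rightarrow> 'c \<Rightarrow> real) \<Rightarrow> bool"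
where
  "cond_density M N Y K Z f \<longleftrightarrow>
     Y \<in> measurable M N \<and> Z \<in> measurable M K \<and>
     (\<lambda>(y, z). f y z) \<in> borel_measurable (N \<Otimes>\<^sub>M K) \<and>
     (\<forall>z\<in>space K. (\<forall>y\<in>space N. 0 \<le> f y z) \<and> (\<integral>\<^sup>+y. ennreal (f y z) \<partial>N) = 1) \<and>
     (\<forall>A\<in>sets K. \<forall>B\<in>sets N.
        emeasure M {\<omega> \<in> space M. Z \<omega> \<in> A \<and> Y \<omega> \<in> B} =
        (\<integral>\<^sup>+z\<in>A. (\<integral>\<^sup>+y\<in>B. ennreal (f y z) \<partial>N) \<partial>distr M K Z))"

text \<open>The \<open>\<sigma>\<close>-algebra \<open>\<sigma>(Z\<^sub>i : i \<in> I)\<close>, as a set of events.\<close>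
definition events_of :: "'a measure \<Rightarrow> (int \<Rightarrow> 'a \<Rightarrow> real) \<Rightarrow> int set \<Rightarrow> 'a set set" where
  "events_of M Z I =
     sigma_sets (space M) {Z i -` A \<inter> space M | i A. i \<in> I \<and> A \<in> sets borel}"

text \<open>
  The dependence coefficients and all bounds are \<open>ennreal\<close>-valued, so every supremum exists and a
  divergent right-hand side is \<open>\<infinity>\<close>.  Suprema over uncountable sets occurring under an integral
  need not be measurable; \<open>nn_integral\<close> is then the lower integral.
\<close>
definition sup_events :: "'a measure \<Rightarrow> 'a set set \<Rightarrow> 'a set set \<Rightarrow> ennreal" where
  "sup_events M \<H> \<G> =
     (SUP H\<in>\<H>. SUP G\<in>\<G>. ennreal \<bar>measure M (G \<inter> H) - measure M G * measure M H\<bar>)"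

definition finite_partitions :: "'a measure \<Rightarrow> 'a set set \<Rightarrow> 'a set set set" where
  "finite_partitions M \<A> = {\<P>. \<P> \<subseteq> \<A> \<and> finite \<P> \<and> partition_on (space M) \<P>}"

definition sup_partitions :: "'a measure \<Rightarrow> 'a set set \<Rightarrow> 'a set set \<Rightarrow> ennreal" where
  "sup_partitions M \<H> \<G> =
     (SUP \<P>\<in>finite_partitions M \<H>. SUP \<Q>\<in>finite_partitions M \<G>.
        \<Sum>G\<in>\<Q>. \<Sum>H\<in>\<P>. ennreal \<bar>measure M (G \<inter> H) - measure M G * measure M H\<bar>)"

end

theory Submission
  imports Defs
begin

text \<open>
  Let \<open>f\<close> be a conditional density of \<open>Y\<close> given \<open>Z\<close>, and for events \<open>G = {Y \<in> B}\<close>, \<open>H = {Z \<in> A}\<close>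
  put \<open>q(z) = \<integral>\<^sub>B f(y | z) dy\<close>.  Then \<open>P(G \<inter> H) - P(G) P(H)\<close> is the expectation of
  \<open>(q(Z) - q(0)) (1\<^sub>H - P(H))\<close>.  Summing absolute values over a partition in \<open>H\<close> gives a factor
  at most \<open>2\<close> and summing over a partition in \<open>G\<close> gives at most
  \<open>\<integral> |f(y | Z) - f(y | 0)| dy\<close>, which is at most its supremum over the box on \<open>E\<close>
  and at most \<open>2\<close> on the complement of \<open>E\<close>.

  For the bounds through \<open>W\<close>, the same argument is applied to the pair \<open>(Y, W)\<close> in place of
  \<open>Y\<close>: since \<open>W\<close> is independent of \<open>Z\<close>, the conditional density of this pair is the product of
  \<open>f\<^sub>W\<close> with the one-step conditional densities, and the \<open>L\<^sup>1\<close>-distance of two such products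
  telescopes.
\<close>

section \<open>Conditional densities as disintegrations of the joint law\<close>

lemma cond_densityD:
  assumes "cond_density M N Y K Z f"
  shows cond_density_measurable: "Y \<in> measurable M N" "Z \<in> measurable M K"
      "(\<lambda>(y, z). f y z) \<in> borel_measurable (N \<Otimes>\<^sub>M K)"
    and cond_density_nonneg: "\<And>y z. y \<in> space N \<Longrightarrow> z \<in> space K \<Longrightarrow> 0 \<le> f y z"
    and cond_density_nn_integral_eq_1: "\<And>z. z \<in> space K \<Longrightarrow> (\<integral>\<^sup>+y. ennreal (f y z) \<partial>N) = 1"
  using assms unfolding cond_density_def by auto

text \<open>\<open>cond_density\<close> fixes the joint law on rectangles only. Rectangles are
  stable under intersection and generate the product sigma-algebra, and the whole space is itself a
  rectangle of finite mass, so the two measures coincide.\<close>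

lemma cond_density_distr:
  assumes "prob_space M" and "sigma_finite_measure N" and cd: "cond_density M N Y K Z f"
  shows "distr M (N \<Otimes>\<^sub>M K) (\<lambda>\<omega>. (Y \<omega>, Z \<omega>)) =
         density (N \<Otimes>\<^sub>M distr M K Z) (\<lambda>(y, z). ennreal (f y z))"
proof -
  interpret prob_space M by fact
  interpret N: sigma_finite_measure N by fact
  note [measurable] = cond_density_measurable[OF cd]
  interpret Z: prob_space "distr M K Z" by (rule prob_space_distr) simp
  interpret P: pair_sigma_finite N "distr M K Z" ..
  let ?D = "distr M (N \<Otimes>\<^sub>M K) (\<lambda>\<omega>. (Y \<omega>, Z \<omega>))"
  let ?E = "{B \<times> A | B A. B \<in> sets N \<and> A \<in> sets K}"
  show ?thesis
  proof (rule measure_eqI_generator_eq[OF Int_stable_pair_measure_generator[of N K],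
        where \<Omega> = "space N \<times> space K" and A = "\<lambda>_::nat. space N \<times> space K"])
    show "?E \<subseteq> Pow (space N \<times> space K)"
      by (rule pair_measure_closed)
    show "sets ?D = sigma_sets (space N \<times> space K) ?E"
      by (simp add: sets_pair_measure)
    have "sets (N \<Otimes>\<^sub>M distr M K Z) = sets (N \<Otimes>\<^sub>M K)"
      by (intro sets_pair_measure_cong) auto
    then show "sets (density (N \<Otimes>\<^sub>M distr M K Z) (\<lambda>(y, z). ennreal (f y z)))
        = sigma_sets (space N \<times> space K) ?E"
      by (simp add: sets_pair_measure)
    show "range (\<lambda>_::nat. space N \<times> space K) \<subseteq> ?E" by auto
    show "(\<Union>i::nat. space N \<times> space K) = space N \<times> space K" by simp
    show "emeasure ?D (space N \<times> space K) \<noteq> \<infinity>" for i :: nat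
      using finite_measure.emeasure_finite[OF finite_measure_distr[of "\<lambda>\<omega>. (Y \<omega>, Z \<omega>)" "N \<Otimes>\<^sub>M K"]]
      by auto
    fix C assume "C \<in> ?E"
    then obtain B A where C: "C = B \<times> A" and [measurable]: "B \<in> sets N" "A \<in> sets K" by blast
    have "emeasure ?D C = emeasure M {\<omega> \<in> space M. Z \<omega> \<in> A \<and> Y \<omega> \<in> B}"
      unfolding C by (subst emeasure_distr) (auto intro!: arg_cong2[where f = emeasure])
    also have "\<dots> = (\<integral>\<^sup>+z\<in>A. (\<integral>\<^sup>+y\<in>B. ennreal (f y z) \<partial>N) \<partial>distr M K Z)"
      using cd by (simp add: cond_density_def)
    also have "\<dots> = (\<integral>\<^sup>+z. (\<integral>\<^sup>+y. ennreal (f y z) * indicator C (y, z) \<partial>N) \<partial>distr M K Z)"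
      unfolding C by (intro nn_integral_cong)
        (simp add: nn_integral_multc[symmetric] indicator_times mult.assoc)
    also have "\<dots> = (\<integral>\<^sup>+p. (case p of (y, z) \<Rightarrow> ennreal (f y z)) * indicator C p \<partial>(N \<Otimes>\<^sub>M distr M K Z))"
      unfolding C by (subst P.nn_integral_snd[symmetric]) simp_all
    also have "\<dots> = emeasure (density (N \<Otimes>\<^sub>M distr M K Z) (\<lambda>(y, z). ennreal (f y z))) C"
      unfolding C by (subst emeasure_density) simp_all
    finally show "emeasure ?D C = emeasure (density (N \<Otimes>\<^sub>M distr M K Z) (\<lambda>(y, z). ennreal (f y z))) C" .
  qed
qed

text \<open>The joint law has a density with respect to a product measure, so Tonelli applies. The
  outer integral is pulled back from the law of \<open>Z\<close> to \<open>M\<close>, which lets the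
  formula be iterated along a chain of conditionings.\<close>

lemma nn_integral_cond_density:
  assumes "prob_space M" and "sigma_finite_measure N" and cd: "cond_density M N Y K Z f"
    and F[measurable]: "F \<in> borel_measurable (N \<Otimes>\<^sub>M K)"
  shows "(\<integral>\<^sup>+\<omega>. F (Y \<omega>, Z \<omega>) \<partial>M) = (\<integral>\<^sup>+\<omega>. (\<integral>\<^sup>+y. ennreal (f y (Z \<omega>)) * F (y, Z \<omega>) \<partial>N) \<partial>M)"
proof -
  interpret prob_space M by fact
  interpret N: sigma_finite_measure N by fact
  note [measurable] = cond_density_measurable[OF cd]
  interpret Z: prob_space "distr M K Z" by (rule prob_space_distr) simp
  interpret P: pair_sigma_finite N "distr M K Z" ..
  have "(\<integral>\<^sup>+\<omega>. F (Y \<omega>, Z \<omega>) \<partial>M) = (\<integral>\<^sup>+p. F p \<partial>distr M (N \<Otimes>\<^sub>M K) (\<lambda>\<omega>. (Y \<omega>, Z \<omega>)))"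
    by (subst nn_integral_distr) simp_all
  also have "\<dots> = (\<integral>\<^sup>+p. (case p of (y, z) \<Rightarrow> ennreal (f y z)) * F p \<partial>(N \<Otimes>\<^sub>M distr M K Z))"
    unfolding cond_density_distr[OF assms(1-3)] by (rule nn_integral_density) simp_all
  also have "\<dots> = (\<integral>\<^sup>+z. (\<integral>\<^sup>+y. ennreal (f y z) * F (y, z) \<partial>N) \<partial>distr M K Z)"
    by (subst P.nn_integral_snd[symmetric]) simp_all
  also have "\<dots> = (\<integral>\<^sup>+\<omega>. (\<integral>\<^sup>+y. ennreal (f y (Z \<omega>)) * F (y, Z \<omega>) \<partial>N) \<partial>M)"
    by (subst nn_integral_distr) simp_all
  finally show ?thesis .
qed

text \<open>Converse of the integral formula: taking the indicator of a rectangle for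
  \<open>F\<close> gives back the definition. It serves for the product of one-step densities, where
  the identity for general \<open>F\<close> comes out of an induction.\<close>

lemma cond_densityI:
  assumes [measurable]: "Y \<in> measurable M N" "Z \<in> measurable M K"
      "(\<lambda>(y, z). f y z) \<in> borel_measurable (N \<Otimes>\<^sub>M K)"
    and "sigma_finite_measure N"
    and "\<And>y z. y \<in> space N \<Longrightarrow> z \<in> space K \<Longrightarrow> 0 \<le> f y z"
    and "\<And>z. z \<in> space K \<Longrightarrow> (\<integral>\<^sup>+y. ennreal (f y z) \<partial>N) = 1"
    and F: "\<And>F. F \<in> borel_measurable (N \<Otimes>\<^sub>M K) \<Longrightarrow>
      (\<integral>\<^sup>+\<omega>. F (Y \<omega>, Z \<omega>) \<partial>M) = (\<integral>\<^sup>+\<omega>. (\<integral>\<^sup>+y. ennreal (f y (Z \<omega>)) * F (y, Z \<omega>) \<partial>N) \<partial>M)"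
  shows "cond_density M N Y K Z f"
proof -
  interpret N: sigma_finite_measure N by fact
  have "emeasure M {\<omega> \<in> space M. Z \<omega> \<in> A \<and> Y \<omega> \<in> B} =
        (\<integral>\<^sup>+z\<in>A. (\<integral>\<^sup>+y\<in>B. ennreal (f y z) \<partial>N) \<partial>distr M K Z)"
    if [measurable]: "A \<in> sets K" "B \<in> sets N" for A B
  proof -
    have "emeasure M {\<omega> \<in> space M. Z \<omega> \<in> A \<and> Y \<omega> \<in> B} =
        (\<integral>\<^sup>+\<omega>. indicator {\<omega> \<in> space M. Z \<omega> \<in> A \<and> Y \<omega> \<in> B} \<omega> \<partial>M)"
      by simp
    also have "\<dots> = (\<integral>\<^sup>+\<omega>. indicator (B \<times> A) (Y \<omega>, Z \<omega>) \<partial>M)"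
      by (intro nn_integral_cong) (auto simp: indicator_def)
    also have "\<dots> = (\<integral>\<^sup>+\<omega>. (\<integral>\<^sup>+y. ennreal (f y (Z \<omega>)) * indicator (B \<times> A) (y, Z \<omega>) \<partial>N) \<partial>M)"
      by (rule F) simp
    also have "\<dots> = (\<integral>\<^sup>+z. (\<integral>\<^sup>+y. ennreal (f y z) * indicator (B \<times> A) (y, z) \<partial>N) \<partial>distr M K Z)"
      by (subst nn_integral_distr) simp_all
    also have "\<dots> = (\<integral>\<^sup>+z\<in>A. (\<integral>\<^sup>+y\<in>B. ennreal (f y z) \<partial>N) \<partial>distr M K Z)"
      by (intro nn_integral_cong)
        (simp add: nn_integral_multc[symmetric] indicator_times mult.assoc)
    finally show ?thesis .
  qed
  with assms show ?thesis by (simp add: cond_density_def)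
qed

section \<open>Events as preimages under a generating map\<close>

text \<open>A partition makes only the preimages disjoint. The bound for partitions adds up
  integrals over the sets \<open>B G\<close> in the target space, and these stay below the integral
  over the whole space because the \<open>B G\<close> themselves are disjoint.\<close>

lemma disjoint_family_preimages:
  assumes "finite \<Q>" "disjoint \<Q>" "\<And>G. G \<in> \<Q> \<Longrightarrow> \<exists>B\<in>sets N. G = Y -` B \<inter> \<Omega>"
  obtains B where "\<And>G. G \<in> \<Q> \<Longrightarrow> B G \<in> sets N" "\<And>G. G \<in> \<Q> \<Longrightarrow> G = Y -` B G \<inter> \<Omega>"
    "disjoint_family_on B \<Q>"
proof -
  obtain C where C: "\<And>G. G \<in> \<Q> \<Longrightarrow> C G \<in> sets N" "\<And>G. G \<in> \<Q> \<Longrightarrow> G = Y -` C G \<inter> \<Omega>"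
    using assms(3) by metis
  \<comment> \<open>The \<open>C G\<close> may overlap outside the range of \<open>Y\<close>; discarding the overlaps leaves the preimages unchanged.\<close>
  show thesis
  proof (rule that[of "\<lambda>G. C G - (\<Union>G'\<in>\<Q> - {G}. C G')"])
    show "C G - (\<Union>G'\<in>\<Q> - {G}. C G') \<in> sets N" if "G \<in> \<Q>" for G
      using that assms(1) C(1) by (intro sets.Diff sets.finite_UN) auto
    show "G = Y -` (C G - (\<Union>G'\<in>\<Q> - {G}. C G')) \<inter> \<Omega>" if "G \<in> \<Q>" for G
    proof -
      have "Y x \<notin> C G'" if "x \<in> G" "G' \<in> \<Q> - {G}" for x G'
      proof
        assume "Y x \<in> C G'"
        moreover have "x \<in> \<Omega>" using C(2)[OF \<open>G \<in> \<Q>\<close>] that(1) by auto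
        ultimately have "x \<in> G'" using C(2)[of G'] that(2) by auto
        then show False using disjointD[OF assms(2) \<open>G \<in> \<Q>\<close>, of G'] that by auto
      qed
      then show ?thesis using C(2)[OF that] by auto
    qed
    show "disjoint_family_on (\<lambda>G. C G - (\<Union>G'\<in>\<Q> - {G}. C G')) \<Q>"
      unfolding disjoint_family_on_def
    proof (intro ballI impI equals0I)
      fix G G' x
      assume "G \<in> \<Q>" "G' \<in> \<Q>" "G \<noteq> G'"
        and "x \<in> (C G - (\<Union>G'\<in>\<Q> - {G}. C G')) \<inter> (C G' - (\<Union>G\<in>\<Q> - {G'}. C G))"
      then show False using UN_I[of G' "\<Q> - {G}" x C] by simp
    qed
  qed
qed

text \<open>The preimages under \<open>V\<close> form a sigma-algebra, so it suffices to place the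
  generators in it, and each \<open>Z i\<close> factors through \<open>V\<close>.\<close>

lemma events_of_subset_vimage:
  assumes V: "V \<in> measurable M K"
    and Z: "\<And>i. i \<in> I \<Longrightarrow> \<exists>\<phi>\<in>borel_measurable K. \<forall>\<omega>\<in>space M. Z i \<omega> = \<phi> (V \<omega>)"
  shows "events_of M Z I \<subseteq> {V -` B \<inter> space M | B. B \<in> sets K}"
proof -
  let ?V = "vimage_algebra (space M) V K"
  have sets_V: "sets ?V = {V -` B \<inter> space M | B. B \<in> sets K}"
    using measurable_space[OF V] by (intro sets_vimage_algebra2) auto
  have "Z i -` A \<inter> space M \<in> sets ?V" if "i \<in> I" "A \<in> sets borel" for i A
  proof -
    obtain \<phi> where \<phi>: "\<phi> \<in> borel_measurable K" "\<forall>\<omega>\<in>space M. Z i \<omega> = \<phi> (V \<omega>)"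
      using Z[OF \<open>i \<in> I\<close>] by blast
    have "Z i -` A \<inter> space M = V -` (\<phi> -` A \<inter> space K) \<inter> space M"
      using \<phi>(2) measurable_space[OF V] by auto
    moreover have "\<phi> -` A \<inter> space K \<in> sets K"
      using \<phi>(1) that(2) by (rule measurable_sets)
    ultimately show ?thesis unfolding sets_V by blast
  qed
  then have "{Z i -` A \<inter> space M | i A. i \<in> I \<and> A \<in> sets borel} \<subseteq> sets ?V" by blast
  from sets.sigma_sets_subset[OF this] show ?thesis
    by (simp add: events_of_def sets_V)
qed

section \<open>Covariance bounds from a single conditional density\<close>

text \<open>The target space stays abstract because the bounds are used twice: for the future vector
  alone and for the future vector paired with \<open>W\<close>. The reference point
  \<open>z0\<close> is the zero vector in both uses; the bounds hold for any point of
  \<open>space K\<close>.\<close>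

locale cond_density_space = prob_space M + N: sigma_finite_measure N for M :: "'a measure" and N :: "'b measure" +
  fixes Y :: "'a \<Rightarrow> 'b" and K :: "'c measure" and Z :: "'a \<Rightarrow> 'c" and f :: "'b \<Rightarrow> 'c \<Rightarrow> real" and z0 :: 'c
  assumes cd: "cond_density M N Y K Z f" and z0: "z0 \<in> space K"
begin

lemmas [measurable] = cond_density_measurable[OF cd] z0
lemmas f_nonneg = cond_density_nonneg[OF cd]
lemmas f_prob = cond_density_nn_integral_eq_1[OF cd]

lemma measurable_Z_space[simp]: "\<omega> \<in> space M \<Longrightarrow> Z \<omega> \<in> space K"
  using cond_density_measurable(2)[OF cd] by (rule measurable_space)

lemma integrable_f: "z \<in> space K \<Longrightarrow> integrable N (\<lambda>y. f y z)"
  by (intro integrableI_nonneg AE_I2) (auto simp: f_nonneg f_prob)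

text \<open>With \<open>q (Z \<omega>)\<close> as conditional probability of \<open>G\<close>, the
  covariance is the mean of \<open>q (Z \<omega>)\<close> times the centred indicator of
  \<open>H\<close>, and centring allows the constant \<open>q z0\<close> to be subtracted at no
  cost. The bound keeps both the restriction to \<open>B\<close> and the weight of \<open>H\<close>,
  so that it can be summed over partitions on either side.\<close>

lemma covariance_le:
  assumes [measurable]: "B \<in> sets N" "A \<in> sets K"
  defines "G \<equiv> Y -` B \<inter> space M" and "H \<equiv> Z -` A \<inter> space M"
  shows "ennreal \<bar>prob (G \<inter> H) - prob G * prob H\<bar> \<le>
    (\<integral>\<^sup>+\<omega>. (\<integral>\<^sup>+y\<in>B. ennreal \<bar>f y (Z \<omega>) - f y z0\<bar> \<partial>N) * (indicator H \<omega> + ennreal (prob H)) \<partial>M)"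
proof -
  \<comment> \<open>A real-valued integral, since differences of \<open>q\<close> are taken
    below.\<close>
  define q where "q z = (\<integral>y. indicator B y * f y z \<partial>N)" for z
  have [measurable]: "G \<in> sets M" "H \<in> sets M" by (simp_all add: G_def H_def)
  have [measurable]: "q \<in> borel_measurable K" unfolding q_def by measurable
  have int: "integrable N (\<lambda>y. indicator B y * f y z)" if "z \<in> space K" for z
    using integrable_real_mult_indicator[OF assms(1) integrable_f[OF that]] by (simp add: mult.commute)
  have q_ennreal: "ennreal (q z) = (\<integral>\<^sup>+y\<in>B. ennreal (f y z) \<partial>N)" if "z \<in> space K" for z
    unfolding q_def using int[OF that] that
    by (subst nn_integral_eq_integral[symmetric])
      (auto simp: f_nonneg indicator_def intro!: nn_integral_cong)
  have q_nonneg: "0 \<le> q z" if "z \<in> space K" for z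
    unfolding q_def using that by (intro integral_nonneg_AE AE_I2) (auto simp: f_nonneg)
  have q_le: "q z \<le> 1" if "z \<in> space K" for z
  proof -
    have "ennreal (q z) \<le> (\<integral>\<^sup>+y. ennreal (f y z) \<partial>N)"
      unfolding q_ennreal[OF that] by (intro nn_integral_mono) (auto simp: indicator_def)
    then show ?thesis by (simp add: f_prob that)
  qed
  have q_diff: "ennreal \<bar>q z - q z0\<bar> \<le> (\<integral>\<^sup>+y\<in>B. ennreal \<bar>f y z - f y z0\<bar> \<partial>N)" if "z \<in> space K" for z
  proof -
    have "q z - q z0 = (\<integral>y. indicator B y * (f y z - f y z0) \<partial>N)"
      unfolding q_def right_diff_distrib
      by (rule Bochner_Integration.integral_diff[symmetric]) (simp_all add: int that z0)
    also have "ennreal \<bar>\<dots>\<bar> \<le> (\<integral>\<^sup>+y. ennreal (norm (indicator B y * (f y z - f y z0))) \<partial>N)"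
      unfolding real_norm_def[symmetric] using that
      by (intro integral_norm_bound_ennreal)
        (simp add: right_diff_distrib int that z0)
    also have "\<dots> = (\<integral>\<^sup>+y\<in>B. ennreal \<bar>f y z - f y z0\<bar> \<partial>N)"
      by (intro nn_integral_cong) (auto simp: indicator_def)
    finally show ?thesis .
  qed
  have prob_q: "prob (G \<inter> Z -` C) = (\<integral>\<omega>. q (Z \<omega>) * indicator C (Z \<omega>) \<partial>M)"
    if [measurable]: "C \<in> sets K" for C
  proof -
    have "emeasure M (G \<inter> Z -` C) = emeasure M {\<omega> \<in> space M. Z \<omega> \<in> C \<and> Y \<omega> \<in> B}"
      by (intro arg_cong2[where f = emeasure]) (auto simp: G_def)
    also have "\<dots> = (\<integral>\<^sup>+z\<in>C. ennreal (q z) \<partial>distr M K Z)"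
      using cd by (auto simp: cond_density_def q_ennreal intro!: nn_integral_cong)
    also have "\<dots> = (\<integral>\<^sup>+\<omega>. ennreal (q (Z \<omega>) * indicator C (Z \<omega>)) \<partial>M)"
      by (subst nn_integral_distr) (auto simp: indicator_def intro!: nn_integral_cong)
    finally show ?thesis
      by (subst integral_eq_nn_integral) (auto simp: measure_def q_nonneg)
  qed
  have int_M: "integrable M g" if "g \<in> borel_measurable M" "\<And>\<omega>. \<omega> \<in> space M \<Longrightarrow> \<bar>g \<omega>\<bar> \<le> 1" for g :: "'a \<Rightarrow> real"
    using that by (intro integrable_const_bound[where B = 1]) auto
  have intq: "integrable M (\<lambda>\<omega>. q (Z \<omega>))" "integrable M (\<lambda>\<omega>. q (Z \<omega>) * indicator H \<omega>)"
    by (intro int_M; simp add: q_nonneg q_le abs_mult indicator_def)+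
  have intH: "integrable M (\<lambda>\<omega>. indicator H \<omega> :: real)"
    by (intro int_M; simp add: indicator_def)
  \<comment> \<open>\<open>prob_q\<close> is used twice: \<open>space K\<close> for \<open>C\<close>
    gives the probability of \<open>G\<close>, and \<open>A\<close> for \<open>C\<close> gives that
    of the intersection.\<close>
  have "prob G = prob (G \<inter> Z -` space K)"
    by (intro arg_cong[where f = prob]) (auto simp: G_def)
  also have "\<dots> = (\<integral>\<omega>. q (Z \<omega>) \<partial>M)"
    unfolding prob_q[OF sets.top] by (intro Bochner_Integration.integral_cong) auto
  finally have pG: "prob G = (\<integral>\<omega>. q (Z \<omega>) \<partial>M)" .
  have "prob (G \<inter> H) = prob (G \<inter> Z -` A)"
    by (intro arg_cong[where f = prob]) (auto simp: G_def H_def)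
  also have "\<dots> = (\<integral>\<omega>. q (Z \<omega>) * indicator H \<omega> \<partial>M)"
    unfolding prob_q[OF assms(2)]
    by (intro Bochner_Integration.integral_cong) (auto simp: H_def indicator_def)
  finally have pGH: "prob (G \<inter> H) = (\<integral>\<omega>. q (Z \<omega>) * indicator H \<omega> \<partial>M)" .
  \<comment> \<open>The two terms with \<open>q z0\<close> cancel after integration because the
    indicator of \<open>H\<close> has mean \<open>prob H\<close>.\<close>
  have "(\<integral>\<omega>. (q (Z \<omega>) - q z0) * (indicator H \<omega> - prob H) \<partial>M) =
      (\<integral>\<omega>. q (Z \<omega>) * indicator H \<omega> - prob H * q (Z \<omega>) - q z0 * indicator H \<omega> + q z0 * prob H \<partial>M)"
    by (intro Bochner_Integration.integral_cong) (auto simp: algebra_simps)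
  also have "\<dots> = prob (G \<inter> H) - prob H * prob G - q z0 * prob H + q z0 * prob H"
    using intq intH by (simp add: pG pGH prob_space)
  finally have "prob (G \<inter> H) - prob G * prob H = (\<integral>\<omega>. (q (Z \<omega>) - q z0) * (indicator H \<omega> - prob H) \<partial>M)"
    by simp
  also have "ennreal \<bar>\<dots>\<bar> \<le> (\<integral>\<^sup>+\<omega>. ennreal (norm ((q (Z \<omega>) - q z0) * (indicator H \<omega> - prob H))) \<partial>M)"
    unfolding real_norm_def[symmetric]
    using intq intH by (intro integral_norm_bound_ennreal) (simp add: left_diff_distrib right_diff_distrib)
  also have "\<dots> \<le> (\<integral>\<^sup>+\<omega>. (\<integral>\<^sup>+y\<in>B. ennreal \<bar>f y (Z \<omega>) - f y z0\<bar> \<partial>N) * (indicator H \<omega> + ennreal (prob H)) \<partial>M)"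
  proof (rule nn_integral_mono)
    fix \<omega> assume "\<omega> \<in> space M"
    \<comment> \<open>The cruder bound 1 would do for one event, but summed over a partition it
      would grow with the number of sets. The sum \<open>indicator H \<omega> + prob H\<close> adds
      up to 2 over any partition.\<close>
    have "ennreal \<bar>indicator H \<omega> - prob H\<bar> \<le> ennreal (indicator H \<omega> + prob H)"
      by (intro ennreal_leI) (auto simp: indicator_def)
    also have "\<dots> = indicator H \<omega> + ennreal (prob H)"
      by (simp add: indicator_def)
    finally have H_le: "ennreal \<bar>indicator H \<omega> - prob H\<bar> \<le> indicator H \<omega> + ennreal (prob H)" .
    show "ennreal (norm ((q (Z \<omega>) - q z0) * (indicator H \<omega> - prob H))) \<le>
        (\<integral>\<^sup>+y\<in>B. ennreal \<bar>f y (Z \<omega>) - f y z0\<bar> \<partial>N) * (indicator H \<omega> + ennreal (prob H))"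
      unfolding real_norm_def abs_mult ennreal_mult[OF abs_ge_zero abs_ge_zero]
      using \<open>\<omega> \<in> space M\<close> by (intro mult_mono q_diff H_le) auto
  qed
  finally show ?thesis .
qed

text \<open>The factor 2 in the integrand is the total weight left over from the events
  \<open>H\<close>. Where \<open>Z\<close> lies in \<open>S\<close>, the inner integral is at most
  the supremum; elsewhere it is at most 2, the total mass of two probability densities, which makes
  the constant 4.\<close>

lemma nn_integral_dist_le:
  assumes [measurable]: "S \<in> sets K"
  shows "(\<integral>\<^sup>+\<omega>. (\<integral>\<^sup>+y. ennreal \<bar>f y (Z \<omega>) - f y z0\<bar> \<partial>N) * 2 \<partial>M) \<le>
     2 * (SUP z\<in>S. \<integral>\<^sup>+y. ennreal \<bar>f y z - f y z0\<bar> \<partial>N) + 4 * emeasure M (space M - {\<omega> \<in> space M. Z \<omega> \<in> S})"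
    (is "?L \<le> 2 * ?S + 4 * emeasure M ?E")
proof -
  have le_2: "(\<integral>\<^sup>+y. ennreal \<bar>f y z - f y z0\<bar> \<partial>N) \<le> 2" if "z \<in> space K" for z
  proof -
    have "(\<integral>\<^sup>+y. ennreal \<bar>f y z - f y z0\<bar> \<partial>N) \<le> (\<integral>\<^sup>+y. ennreal (f y z) + ennreal (f y z0) \<partial>N)"
    proof (rule nn_integral_mono)
      fix y assume "y \<in> space N"
      with f_nonneg that z0 have "0 \<le> f y z" "0 \<le> f y z0" by auto
      then show "ennreal \<bar>f y z - f y z0\<bar> \<le> ennreal (f y z) + ennreal (f y z0)"
        unfolding ennreal_plus[symmetric, OF \<open>0 \<le> f y z\<close> \<open>0 \<le> f y z0\<close>] by (intro ennreal_leI) linarith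
    qed
    also have "\<dots> = 2"
      using that z0 by (subst nn_integral_add) (simp_all add: f_prob)
    finally show ?thesis .
  qed
  have "?L \<le> (\<integral>\<^sup>+\<omega>. 2 * ?S + 4 * indicator ?E \<omega> \<partial>M)"
  proof (rule nn_integral_mono)
    fix \<omega> assume \<omega>: "\<omega> \<in> space M"
    show "(\<integral>\<^sup>+y. ennreal \<bar>f y (Z \<omega>) - f y z0\<bar> \<partial>N) * 2 \<le> 2 * ?S + 4 * indicator ?E \<omega>"
    proof (cases "Z \<omega> \<in> S")
      case True
      then have "2 * (\<integral>\<^sup>+y. ennreal \<bar>f y (Z \<omega>) - f y z0\<bar> \<partial>N) \<le> 2 * ?S"
        by (intro mult_left_mono SUP_upper) simp_all
      also have "\<dots> \<le> 2 * ?S + 4 * indicator ?E \<omega>" by simp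
      finally show ?thesis by (simp only: mult.commute)
    next
      case False
      have "(\<integral>\<^sup>+y. ennreal \<bar>f y (Z \<omega>) - f y z0\<bar> \<partial>N) * 2 \<le> 2 * 2"
        using \<omega> by (intro mult_right_mono le_2) simp_all
      also have "\<dots> \<le> 2 * ?S + 4 * indicator ?E \<omega>"
        using False \<omega> by (intro add_increasing) simp_all
      finally show ?thesis .
    qed
  qed
  also have "\<dots> = 2 * ?S + 4 * emeasure M ?E"
    by (subst nn_integral_add) (auto simp: nn_integral_cmult emeasure_space_1)
  finally show ?thesis .
qed

text \<open>For a single pair of events the weight of \<open>H\<close> is at most 2, and the
  integral over \<open>B\<close> is enlarged to the whole space.\<close>

lemma sup_events_le:
  assumes "S \<in> sets K"
    and \<H>: "\<H> \<subseteq> {Z -` A \<inter> space M | A. A \<in> sets K}"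
    and \<G>: "\<G> \<subseteq> {Y -` B \<inter> space M | B. B \<in> sets N}"
  shows "sup_events M \<H> \<G> \<le> 2 * (SUP z\<in>S. \<integral>\<^sup>+y. ennreal \<bar>f y z - f y z0\<bar> \<partial>N)
       + 4 * emeasure M (space M - {\<omega> \<in> space M. Z \<omega> \<in> S})"
  unfolding sup_events_def
proof (intro SUP_least)
  fix H G assume "H \<in> \<H>" "G \<in> \<G>"
  from subsetD[OF \<H> \<open>H \<in> \<H>\<close>] obtain A where A: "A \<in> sets K" "H = Z -` A \<inter> space M"
    by auto
  from subsetD[OF \<G> \<open>G \<in> \<G>\<close>] obtain B where B: "B \<in> sets N" "G = Y -` B \<inter> space M"
    by auto
  have "ennreal \<bar>prob (G \<inter> H) - prob G * prob H\<bar> \<le>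
     (\<integral>\<^sup>+\<omega>. (\<integral>\<^sup>+y\<in>B. ennreal \<bar>f y (Z \<omega>) - f y z0\<bar> \<partial>N) * (indicator H \<omega> + ennreal (prob H)) \<partial>M)"
    using covariance_le[OF B(1) A(1)] unfolding A(2) B(2) .
  also have "\<dots> \<le> (\<integral>\<^sup>+\<omega>. (\<integral>\<^sup>+y. ennreal \<bar>f y (Z \<omega>) - f y z0\<bar> \<partial>N) * 2 \<partial>M)"
  proof (intro nn_integral_mono mult_mono)
    show "ennreal \<bar>f y (Z \<omega>) - f y z0\<bar> * indicator B y \<le> ennreal \<bar>f y (Z \<omega>) - f y z0\<bar>" for \<omega> y
      by (simp add: indicator_def)
    show "indicator H \<omega> + ennreal (prob H) \<le> 2" for \<omega>
      unfolding one_add_one[symmetric] by (intro add_mono) (simp_all add: indicator_def)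
  qed simp_all
  also note nn_integral_dist_le[OF assms(1)]
  finally show "ennreal \<bar>prob (G \<inter> H) - prob G * prob H\<bar> \<le> 2 * (SUP z\<in>S. \<integral>\<^sup>+y. ennreal \<bar>f y z - f y z0\<bar> \<partial>N)
       + 4 * emeasure M (space M - {\<omega> \<in> space M. Z \<omega> \<in> S})" .
qed

text \<open>Partitions cost nothing compared with single events: the weights of the \<open>H\<close>
  add up to exactly 2 at each point, and the integrals over the disjoint \<open>B G\<close> add up
  to at most the full one. The supremum over \<open>S\<close> therefore still stands outside the
  integral.\<close>

lemma sup_partitions_le:
  assumes "S \<in> sets K"
    and \<H>: "\<H> \<subseteq> {Z -` A \<inter> space M | A. A \<in> sets K}"
    and \<G>: "\<G> \<subseteq> {Y -` B \<inter> space M | B. B \<in> sets N}"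
  shows "sup_partitions M \<H> \<G> \<le> 2 * (SUP z\<in>S. \<integral>\<^sup>+y. ennreal \<bar>f y z - f y z0\<bar> \<partial>N)
       + 4 * emeasure M (space M - {\<omega> \<in> space M. Z \<omega> \<in> S})"
  unfolding sup_partitions_def
proof (intro SUP_least)
  fix \<P> \<Q> assume "\<P> \<in> finite_partitions M \<H>" "\<Q> \<in> finite_partitions M \<G>"
  then have P: "finite \<P>" "\<P> \<subseteq> \<H>" "partition_on (space M) \<P>"
    and Q: "finite \<Q>" "\<Q> \<subseteq> \<G>" "partition_on (space M) \<Q>"
    by (auto simp: finite_partitions_def)
  have "\<exists>B\<in>sets N. G = Y -` B \<inter> space M" if "G \<in> \<Q>" for G
    using subsetD[OF \<G> subsetD[OF Q(2) that]] by auto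
  from disjoint_family_preimages[OF Q(1) partition_onD2[OF Q(3)] this]
  obtain B where B[measurable]: "\<And>G. G \<in> \<Q> \<Longrightarrow> B G \<in> sets N"
    and BG: "\<And>G. G \<in> \<Q> \<Longrightarrow> G = Y -` B G \<inter> space M"
    and disj: "disjoint_family_on B \<Q>" by blast
  have H: "\<exists>A\<in>sets K. H = Z -` A \<inter> space M" if "H \<in> \<P>" for H
    using subsetD[OF \<H> subsetD[OF P(2) that]] by auto
  have [measurable]: "H \<in> sets M" if "H \<in> \<P>" for H
    using H[OF that] measurable_sets[OF cond_density_measurable(2)[OF cd]] by auto
  have sum_prob: "(\<Sum>H\<in>\<P>. ennreal (prob H)) = 1"
  proof -
    have "(\<Sum>H\<in>\<P>. ennreal (prob H)) = (\<Sum>H\<in>\<P>. emeasure M H)"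
      by (simp add: emeasure_eq_measure)
    also have "\<dots> = emeasure M (\<Union>H\<in>\<P>. H)"
      using P(1) partition_onD2[OF P(3)]
      by (intro sum_emeasure) (auto simp: disjoint_family_on_def disjoint_def)
    also have "\<dots> = 1"
      using partition_onD1[OF P(3)] emeasure_space_1 by simp
    finally show ?thesis .
  qed
  have sum_ind: "(\<Sum>H\<in>\<P>. indicator H \<omega>) = (1::ennreal)" if "\<omega> \<in> space M" for \<omega>
  proof -
    have "\<omega> \<in> \<Union>\<P>" using that partition_onD1[OF P(3)] by simp
    then obtain H where "H \<in> \<P>" "\<omega> \<in> H" by (rule UnionE)
    have "indicator H' \<omega> = (if H' = H then 1 else 0 :: ennreal)" if "H' \<in> \<P>" for H'
      using disjointD[OF partition_onD2[OF P(3)] \<open>H \<in> \<P>\<close> that] \<open>\<omega> \<in> H\<close>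
      by (auto simp: indicator_def)
    then have "(\<Sum>H'\<in>\<P>. indicator H' \<omega>) = (\<Sum>H'\<in>\<P>. if H' = H then 1 else 0 :: ennreal)"
      by (rule sum.cong[OF refl])
    with P(1) \<open>H \<in> \<P>\<close> show ?thesis by simp
  qed
  let ?D = "\<lambda>\<omega> G. \<integral>\<^sup>+y\<in>B G. ennreal \<bar>f y (Z \<omega>) - f y z0\<bar> \<partial>N"
  have "(\<Sum>G\<in>\<Q>. \<Sum>H\<in>\<P>. ennreal \<bar>prob (G \<inter> H) - prob G * prob H\<bar>) \<le>
     (\<Sum>G\<in>\<Q>. \<Sum>H\<in>\<P>. \<integral>\<^sup>+\<omega>. ?D \<omega> G * (indicator H \<omega> + ennreal (prob H)) \<partial>M)"
  proof (intro sum_mono)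
    fix G H assume "G \<in> \<Q>" "H \<in> \<P>"
    then obtain A where "A \<in> sets K" "H = Z -` A \<inter> space M" using H by blast
    with covariance_le[OF B[OF \<open>G \<in> \<Q>\<close>] this(1)] BG[OF \<open>G \<in> \<Q>\<close>]
    show "ennreal \<bar>prob (G \<inter> H) - prob G * prob H\<bar> \<le> (\<integral>\<^sup>+\<omega>. ?D \<omega> G * (indicator H \<omega> + ennreal (prob H)) \<partial>M)"
      by simp
  qed
  also have "\<dots> = (\<Sum>G\<in>\<Q>. \<integral>\<^sup>+\<omega>. (\<Sum>H\<in>\<P>. ?D \<omega> G * (indicator H \<omega> + ennreal (prob H))) \<partial>M)"
    by (intro sum.cong refl nn_integral_sum[symmetric]) measurable
  \<comment> \<open>Each point lies in exactly one \<open>H\<close>, and the probabilities add up to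
    1, so the total weight is 1 + 1.\<close>
  also have "\<dots> = (\<Sum>G\<in>\<Q>. \<integral>\<^sup>+\<omega>. ?D \<omega> G * 2 \<partial>M)"
    by (intro sum.cong refl nn_integral_cong)
      (simp add: sum_distrib_left[symmetric] sum.distrib sum_ind sum_prob)
  also have "\<dots> = (\<integral>\<^sup>+\<omega>. (\<Sum>G\<in>\<Q>. ?D \<omega> G * 2) \<partial>M)"
    by (intro nn_integral_sum[symmetric]) measurable
  also have "\<dots> \<le> (\<integral>\<^sup>+\<omega>. (\<integral>\<^sup>+y. ennreal \<bar>f y (Z \<omega>) - f y z0\<bar> \<partial>N) * 2 \<partial>M)"
  proof (rule nn_integral_mono)
    fix \<omega> assume [simp]: "\<omega> \<in> space M"
    have "(\<Sum>G\<in>\<Q>. ?D \<omega> G) = (\<integral>\<^sup>+y. (\<Sum>G\<in>\<Q>. ennreal \<bar>f y (Z \<omega>) - f y z0\<bar> * indicator (B G) y) \<partial>N)"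
      by (intro nn_integral_sum[symmetric]) measurable
    also have "\<dots> \<le> (\<integral>\<^sup>+y. ennreal \<bar>f y (Z \<omega>) - f y z0\<bar> \<partial>N)"
      unfolding sum_distrib_left[symmetric]
    proof (rule nn_integral_mono)
      fix y
      \<comment> \<open>Here disjointness is needed at every \<open>y\<close> of the target space,
        including points outside the range of \<open>Y\<close>.\<close>
      have "(\<Sum>G\<in>\<Q>. indicator (B G) y) = (indicator (\<Union>G\<in>\<Q>. B G) y :: ennreal)"
        by (rule indicator_UN_disjoint[OF Q(1) disj, symmetric])
      then show "ennreal \<bar>f y (Z \<omega>) - f y z0\<bar> * (\<Sum>G\<in>\<Q>. indicator (B G) y) \<le> ennreal \<bar>f y (Z \<omega>) - f y z0\<bar>"
        by (simp add: indicator_def)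
    qed
    finally show "(\<Sum>G\<in>\<Q>. ?D \<omega> G * 2) \<le> (\<integral>\<^sup>+y. ennreal \<bar>f y (Z \<omega>) - f y z0\<bar> \<partial>N) * 2"
      unfolding sum_distrib_right[symmetric] by (rule mult_right_mono) simp
  qed
  also note nn_integral_dist_le[OF assms(1)]
  finally show "(\<Sum>G\<in>\<Q>. \<Sum>H\<in>\<P>. ennreal \<bar>prob (G \<inter> H) - prob G * prob H\<bar>)
      \<le> 2 * (SUP z\<in>S. \<integral>\<^sup>+y. ennreal \<bar>f y z - f y z0\<bar> \<partial>N)
       + 4 * emeasure M (space M - {\<omega> \<in> space M. Z \<omega> \<in> S})" .
qed

end

section \<open>Chaining one-step conditional densities\<close>

interpretation lborel_prod: product_sigma_finite "\<lambda>_::nat. lborel :: real measure"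
  by standard

lemma nn_integral_lborel_vec_Suc:
  assumes "f \<in> borel_measurable (lborel_vec {..<Suc m})"
  shows "(\<integral>\<^sup>+y. f y \<partial>lborel_vec {..<Suc m}) = (\<integral>\<^sup>+y. (\<integral>\<^sup>+v. f (y(m := v)) \<partial>lborel) \<partial>lborel_vec {..<m})"
  using assms unfolding lessThan_Suc by (intro lborel_prod.product_nn_integral_insert) auto

lemma measurable_lborel_vec_upd[measurable (raw)]:
  assumes "y \<in> measurable N (lborel_vec {..<m})" "v \<in> measurable N lborel"
  shows "(\<lambda>\<omega>. (y \<omega>)(m := v \<omega>)) \<in> measurable N (lborel_vec {..<Suc m})"
  by (rule measurable_fun_upd[OF _ assms]) auto

text \<open>In the application \<open>U s\<close> is the process at time \<open>t + k + s\<close>,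
  \<open>V\<close> is the vector of the \<open>W\<close>, \<open>Z\<close> is the past vector and
  \<open>n\<close> is \<open>Suc r2\<close>. Independence of \<open>V\<close> and \<open>Z\<close>
  is stated as a product law, the form to which Tonelli applies directly.\<close>

locale chained_density = prob_space M + L: sigma_finite_measure L
  for M :: "'a measure" and L :: "'b measure" +
  fixes V :: "'a \<Rightarrow> 'b" and K :: "'c measure" and Z :: "'a \<Rightarrow> 'c" and U :: "nat \<Rightarrow> 'a \<Rightarrow> real"
    and g :: "'b \<Rightarrow> real" and h :: "nat \<Rightarrow> real \<Rightarrow> (nat \<Rightarrow> real) \<Rightarrow> 'b \<Rightarrow> 'c \<Rightarrow> real" and n :: nat
  assumes g_nonneg: "\<And>w. w \<in> space L \<Longrightarrow> 0 \<le> g w"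
    and V_distributed: "distributed M L V (\<lambda>w. ennreal (g w))"
    and Z_measurable: "Z \<in> measurable M K"
    and V_indep: "distr M L V \<Otimes>\<^sub>M distr M K Z = distr M (L \<Otimes>\<^sub>M K) (\<lambda>\<omega>. (V \<omega>, Z \<omega>))"
    and cd_h: "\<And>s. s < n \<Longrightarrow> cond_density M lborel (U s) (lborel_vec {..<s} \<Otimes>\<^sub>M L \<Otimes>\<^sub>M K)
      (\<lambda>\<omega>. (\<lambda>i\<in>{..<s}. U i \<omega>, V \<omega>, Z \<omega>)) (\<lambda>v (y, w, x). h s v y w x)"
begin

text \<open>The chain-rule product of the one-step densities. Restricting \<open>y\<close> to
  \<open>{..<s}\<close> turns it into the extensional history vector on which \<open>h s\<close> is
  specified.\<close>

definition joint :: "nat \<Rightarrow> (nat \<Rightarrow> real) \<Rightarrow> 'b \<Rightarrow> 'c \<Rightarrow> real" where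
  "joint m y w x = (\<Prod>s<m. h s (y s) (restrict y {..<s}) w x)"

declare Z_measurable[measurable]

lemma V_measurable[measurable]: "V \<in> measurable M L"
  using V_distributed by (simp add: distributed_def)

lemma g_measurable[measurable]: "(\<lambda>w. ennreal (g w)) \<in> borel_measurable L"
  using V_distributed by (simp add: distributed_def)

text \<open>\<open>distributed\<close> gives measurability of \<open>ennreal (g w)\<close> only;
  since \<open>g\<close> is nonnegative on \<open>space L\<close>, \<open>enn2real\<close> recovers
  \<open>g\<close> there.\<close>

lemma g_real_measurable: "g \<in> borel_measurable L"
proof -
  have "(\<lambda>w. enn2real (ennreal (g w))) \<in> borel_measurable L" by measurable
  then show ?thesis
    by (rule measurable_cong[THEN iffD1, rotated]) (simp add: g_nonneg)
qed

lemma Z_space[simp]: "\<omega> \<in> space M \<Longrightarrow> Z \<omega> \<in> space K"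
  using Z_measurable by (rule measurable_space)

lemma U_measurable: "s < n \<Longrightarrow> U s \<in> borel_measurable M"
  using cond_density_measurable(1)[OF cd_h] by simp

lemma U_vec_measurable: "m \<le> n \<Longrightarrow> (\<lambda>\<omega>. \<lambda>i\<in>{..<m}. U i \<omega>) \<in> measurable M (lborel_vec {..<m})"
  by (intro measurable_restrict) (simp add: U_measurable)

lemma h_measurable[measurable (raw)]:
  assumes "s < n" and [measurable]: "v \<in> measurable N lborel" "y \<in> measurable N (lborel_vec {..<s})"
    "w \<in> measurable N L" "x \<in> measurable N K"
  shows "(\<lambda>\<omega>. h s (v \<omega>) (y \<omega>) (w \<omega>) (x \<omega>)) \<in> borel_measurable N"
proof -
  have "(\<lambda>\<omega>. (v \<omega>, y \<omega>, w \<omega>, x \<omega>)) \<in> measurable N (lborel \<Otimes>\<^sub>M lborel_vec {..<s} \<Otimes>\<^sub>M L \<Otimes>\<^sub>M K)"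
    by measurable
  from measurable_compose[OF this cond_density_measurable(3)[OF cd_h[OF assms(1)]]]
  show ?thesis by simp
qed

lemma joint_measurable[measurable (raw)]:
  assumes "m \<le> n" and y: "y \<in> measurable N (lborel_vec {..<m})"
    and [measurable]: "w \<in> measurable N L" "x \<in> measurable N K"
  shows "(\<lambda>\<omega>. joint m (y \<omega>) (w \<omega>) (x \<omega>)) \<in> borel_measurable N"
  unfolding joint_def
proof (rule borel_measurable_prod)
  fix s assume s: "s \<in> {..<m}"
  then have "(\<lambda>y. y s) \<in> measurable (lborel_vec {..<m}) lborel"
    "(\<lambda>y. restrict y {..<s}) \<in> measurable (lborel_vec {..<m}) (lborel_vec {..<s})"
    by (auto intro!: measurable_restrict_subset measurable_component_singleton)
  from this[THEN measurable_compose[OF y]] s assms(1)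
  show "(\<lambda>\<omega>. h s (y \<omega> s) (restrict (y \<omega>) {..<s}) (w \<omega>) (x \<omega>)) \<in> borel_measurable N"
    by (intro h_measurable) auto
qed

lemma h_nonneg:
  "s < n \<Longrightarrow> y \<in> space (lborel_vec {..<s}) \<Longrightarrow> w \<in> space L \<Longrightarrow> x \<in> space K \<Longrightarrow> 0 \<le> h s v y w x"
  using cond_density_nonneg[OF cd_h, of s v "(y, w, x)"] by (simp add: space_pair_measure)

lemma h_prob:
  "s < n \<Longrightarrow> y \<in> space (lborel_vec {..<s}) \<Longrightarrow> w \<in> space L \<Longrightarrow> x \<in> space K \<Longrightarrow>
    (\<integral>\<^sup>+v. ennreal (h s v y w x) \<partial>lborel) = 1"
  using cond_density_nn_integral_eq_1[OF cd_h, of s "(y, w, x)"] by (simp add: space_pair_measure)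

lemma g_prob: "(\<integral>\<^sup>+w. ennreal (g w) \<partial>L) = 1"
proof -
  have "(\<integral>\<^sup>+w. ennreal (g w) \<partial>L) = emeasure (density L (\<lambda>w. ennreal (g w))) (space L)"
    by (subst emeasure_density) (auto intro!: nn_integral_cong)
  also have "density L (\<lambda>w. ennreal (g w)) = distr M L V"
    using V_distributed by (simp add: distributed_def)
  also have "emeasure (distr M L V) (space L) = 1"
    using prob_space.emeasure_space_1[OF prob_space_distr[OF V_measurable]] by simp
  finally show ?thesis .
qed

lemma joint_nonneg:
  "m \<le> n \<Longrightarrow> w \<in> space L \<Longrightarrow> x \<in> space K \<Longrightarrow> 0 \<le> joint m y w x"
  unfolding joint_def by (intro prod_nonneg) (auto simp: space_PiM intro!: h_nonneg)

text \<open>The earlier factors do not see coordinate \<open>m\<close>, and the history of the new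
  factor is \<open>y\<close> itself because \<open>y\<close> is extensional on
  \<open>{..<m}\<close>.\<close>

lemma joint_Suc:
  assumes "y \<in> space (lborel_vec {..<m})"
  shows "joint (Suc m) (y(m := v)) w x = joint m y w x * h m v y w x"
proof -
  have "restrict (y(m := v)) {..<m} = y"
    using assms by (auto simp: space_PiM PiE_def extensional_def restrict_def fun_eq_iff)
  moreover have "joint m (y(m := v)) w x = joint m y w x"
    unfolding joint_def
  proof (rule prod.cong)
    fix s assume "s \<in> {..<m}"
    then have "restrict (y(m := v)) {..<s} = restrict y {..<s}"
      by (auto simp: restrict_def fun_eq_iff)
    then show "h s ((y(m := v)) s) (restrict (y(m := v)) {..<s}) w x = h s (y s) (restrict y {..<s}) w x"
      using \<open>s \<in> {..<m}\<close> by simp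
  qed simp
  ultimately show ?thesis by (simp add: joint_def)
qed

text \<open>The last coordinate is integrated first, and its one-step density has mass 1 for every
  history. Regularity of the versions makes this hold at every \<open>w\<close> and
  \<open>x\<close>, in particular at the reference point.\<close>

lemma nn_integral_joint:
  assumes "m \<le> n" "w \<in> space L" "x \<in> space K"
  shows "(\<integral>\<^sup>+y. ennreal (joint m y w x) \<partial>lborel_vec {..<m}) = 1"
  using assms(1)
proof (induction m)
  case 0
  then show ?case by (simp add: joint_def PiM_empty)
next
  case (Suc m)
  note [measurable] = assms(2,3)
  have "(\<integral>\<^sup>+y. ennreal (joint (Suc m) y w x) \<partial>lborel_vec {..<Suc m}) =
      (\<integral>\<^sup>+y. (\<integral>\<^sup>+v. ennreal (joint (Suc m) (y(m := v)) w x) \<partial>lborel) \<partial>lborel_vec {..<m})"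
    using Suc.prems by (intro nn_integral_lborel_vec_Suc) measurable
  also have "\<dots> = (\<integral>\<^sup>+y. ennreal (joint m y w x) \<partial>lborel_vec {..<m})"
  proof (rule nn_integral_cong)
    fix y assume [measurable]: "y \<in> space (lborel_vec {..<m})"
    have "(\<integral>\<^sup>+v. ennreal (joint (Suc m) (y(m := v)) w x) \<partial>lborel) =
        (\<integral>\<^sup>+v. ennreal (joint m y w x) * ennreal (h m v y w x) \<partial>lborel)"
      using assms Suc.prems \<open>y \<in> _\<close>
      by (intro nn_integral_cong) (simp add: joint_Suc ennreal_mult joint_nonneg h_nonneg)
    also have "\<dots> = ennreal (joint m y w x) * (\<integral>\<^sup>+v. ennreal (h m v y w x) \<partial>lborel)"
      using Suc.prems by (intro nn_integral_cmult) measurable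
    finally show "(\<integral>\<^sup>+v. ennreal (joint (Suc m) (y(m := v)) w x) \<partial>lborel) = ennreal (joint m y w x)"
      using assms Suc.prems \<open>y \<in> _\<close> by (simp add: h_prob)
  qed
  also have "\<dots> = 1" using Suc by simp
  finally show ?case .
qed

text \<open>By independence the law of the pair is a product, so \<open>g\<close> also acts as
  conditional density of \<open>V\<close> given \<open>Z\<close>.\<close>

lemma nn_integral_V_Z:
  assumes [measurable]: "F \<in> borel_measurable (L \<Otimes>\<^sub>M K)"
  shows "(\<integral>\<^sup>+\<omega>. F (V \<omega>, Z \<omega>) \<partial>M) = (\<integral>\<^sup>+\<omega>. (\<integral>\<^sup>+w. ennreal (g w) * F (w, Z \<omega>) \<partial>L) \<partial>M)"
proof -
  interpret V: prob_space "distr M L V" by (rule prob_space_distr) simp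
  interpret Z: prob_space "distr M K Z" by (rule prob_space_distr) simp
  interpret P: pair_sigma_finite "distr M L V" "distr M K Z" ..
  have F': "F \<in> borel_measurable (distr M L V \<Otimes>\<^sub>M distr M K Z)"
    by measurable
  have "(\<integral>\<^sup>+\<omega>. F (V \<omega>, Z \<omega>) \<partial>M) = (\<integral>\<^sup>+p. F p \<partial>distr M (L \<Otimes>\<^sub>M K) (\<lambda>\<omega>. (V \<omega>, Z \<omega>)))"
    by (subst nn_integral_distr) simp_all
  also have "\<dots> = (\<integral>\<^sup>+p. F p \<partial>(distr M L V \<Otimes>\<^sub>M distr M K Z))"
    by (simp only: V_indep)
  also have "\<dots> = (\<integral>\<^sup>+x. (\<integral>\<^sup>+w. F (w, x) \<partial>distr M L V) \<partial>distr M K Z)"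
    by (rule P.nn_integral_snd[OF F', symmetric])
  also have "\<dots> = (\<integral>\<^sup>+x. (\<integral>\<^sup>+w. ennreal (g w) * F (w, x) \<partial>L) \<partial>distr M K Z)"
  proof (rule nn_integral_cong)
    fix x assume "x \<in> space (distr M K Z)"
    then have [measurable]: "x \<in> space K" by simp
    have "distr M L V = density L (\<lambda>w. ennreal (g w))"
      using V_distributed by (simp add: distributed_def)
    then show "(\<integral>\<^sup>+w. F (w, x) \<partial>distr M L V) = (\<integral>\<^sup>+w. ennreal (g w) * F (w, x) \<partial>L)"
      by (simp only:) (rule nn_integral_density; measurable)
  qed
  also have "\<dots> = (\<integral>\<^sup>+\<omega>. (\<integral>\<^sup>+w. ennreal (g w) * F (w, Z \<omega>) \<partial>L) \<partial>M)"
    by (subst nn_integral_distr) simp_all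
  finally show ?thesis .
qed

text \<open>Chain rule by induction on \<open>m\<close>: conditioning on everything before
  \<open>U m\<close> integrates out the last coordinate. The result is a new test function of the
  shorter vector, hence the generalisation over \<open>F\<close>.\<close>

lemma nn_integral_U_V_Z:
  assumes "m \<le> n" "F \<in> borel_measurable (lborel_vec {..<m} \<Otimes>\<^sub>M L \<Otimes>\<^sub>M K)"
  shows "(\<integral>\<^sup>+\<omega>. F (\<lambda>i\<in>{..<m}. U i \<omega>, V \<omega>, Z \<omega>) \<partial>M) =
    (\<integral>\<^sup>+\<omega>. (\<integral>\<^sup>+w. ennreal (g w) *
      (\<integral>\<^sup>+y. ennreal (joint m y w (Z \<omega>)) * F (y, w, Z \<omega>) \<partial>lborel_vec {..<m}) \<partial>L) \<partial>M)"
  using assms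
proof (induction m arbitrary: F)
  case 0
  \<comment> \<open>The only point of the zero-dimensional space: an extensional function on the
    empty set is \<open>undefined\<close> everywhere.\<close>
  let ?e = "\<lambda>_. undefined :: real"
  have [measurable]: "?e \<in> space (lborel_vec {..<0::nat})" by (simp add: space_PiM)
  note [measurable] = 0(2)
  have "(\<lambda>i\<in>{..<0::nat}. U i \<omega>) = ?e" for \<omega> by (simp add: restrict_def)
  with nn_integral_V_Z[of "\<lambda>(w, x). F (?e, w, x)"]
  show ?case
    by (simp add: joint_def lborel_prod.nn_integral_empty)
next
  case (Suc m)
  then have m: "m < n" by simp
  note [measurable] = Suc.prems(2)
  note [measurable] = U_vec_measurable[of m] U_measurable[of m]
  let ?F = "\<lambda>(v, y, w, x). F (y(m := v), w, x)"
  \<comment> \<open>The average of \<open>F\<close> over its last coordinate given all earlier ones;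
    the induction hypothesis is applied to it.\<close>
  let ?G = "\<lambda>(y, w, x). \<integral>\<^sup>+v. ennreal (h m v y w x) * F (y(m := v), w, x) \<partial>lborel"
  have "(\<lambda>i\<in>{..<Suc m}. U i \<omega>) = (\<lambda>i\<in>{..<m}. U i \<omega>)(m := U m \<omega>)" for \<omega>
    by (auto simp: restrict_def fun_eq_iff)
  then have "(\<integral>\<^sup>+\<omega>. F (\<lambda>i\<in>{..<Suc m}. U i \<omega>, V \<omega>, Z \<omega>) \<partial>M) =
      (\<integral>\<^sup>+\<omega>. ?F (U m \<omega>, (\<lambda>i\<in>{..<m}. U i \<omega>, V \<omega>, Z \<omega>)) \<partial>M)"
    by simp
  also have "\<dots> = (\<integral>\<^sup>+\<omega>. ?G (\<lambda>i\<in>{..<m}. U i \<omega>, V \<omega>, Z \<omega>) \<partial>M)"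
    by (subst nn_integral_cond_density[OF prob_space_axioms _ cd_h[OF m]])
      (simp_all add: lborel.sigma_finite_measure_axioms)
  also have "\<dots> = (\<integral>\<^sup>+\<omega>. (\<integral>\<^sup>+w. ennreal (g w) *
      (\<integral>\<^sup>+y. ennreal (joint m y w (Z \<omega>)) * ?G (y, w, Z \<omega>) \<partial>lborel_vec {..<m}) \<partial>L) \<partial>M)"
    using m by (intro Suc.IH) measurable
  also have "\<dots> = (\<integral>\<^sup>+\<omega>. (\<integral>\<^sup>+w. ennreal (g w) *
      (\<integral>\<^sup>+y. ennreal (joint (Suc m) y w (Z \<omega>)) * F (y, w, Z \<omega>) \<partial>lborel_vec {..<Suc m}) \<partial>L) \<partial>M)"
  proof (intro nn_integral_cong arg_cong2[where f = "(*)"] refl)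
    fix \<omega> w assume "\<omega> \<in> space M" and w[measurable]: "w \<in> space L"
    then have x[measurable]: "Z \<omega> \<in> space K" by simp
    have "(\<integral>\<^sup>+y. ennreal (joint (Suc m) y w (Z \<omega>)) * F (y, w, Z \<omega>) \<partial>lborel_vec {..<Suc m}) =
      (\<integral>\<^sup>+y. (\<integral>\<^sup>+v. ennreal (joint (Suc m) (y(m := v)) w (Z \<omega>)) * F (y(m := v), w, Z \<omega>) \<partial>lborel) \<partial>lborel_vec {..<m})"
      using m by (intro nn_integral_lborel_vec_Suc) measurable
    also have "\<dots> = (\<integral>\<^sup>+y. ennreal (joint m y w (Z \<omega>)) * ?G (y, w, Z \<omega>) \<partial>lborel_vec {..<m})"
    proof (rule nn_integral_cong)
      fix y assume y[measurable]: "y \<in> space (lborel_vec {..<m})"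
      have "(\<integral>\<^sup>+v. ennreal (joint (Suc m) (y(m := v)) w (Z \<omega>)) * F (y(m := v), w, Z \<omega>) \<partial>lborel) =
        (\<integral>\<^sup>+v. ennreal (joint m y w (Z \<omega>)) * (ennreal (h m v y w (Z \<omega>)) * F (y(m := v), w, Z \<omega>)) \<partial>lborel)"
        using m w x y by (intro nn_integral_cong)
          (simp add: joint_Suc ennreal_mult joint_nonneg h_nonneg mult.assoc)
      also have "\<dots> = ennreal (joint m y w (Z \<omega>)) * ?G (y, w, Z \<omega>)"
        using m by (subst nn_integral_cmult) simp_all
      finally show "(\<integral>\<^sup>+v. ennreal (joint (Suc m) (y(m := v)) w (Z \<omega>)) * F (y(m := v), w, Z \<omega>) \<partial>lborel) =
        ennreal (joint m y w (Z \<omega>)) * ?G (y, w, Z \<omega>)" .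
    qed
    finally show "(\<integral>\<^sup>+y. ennreal (joint m y w (Z \<omega>)) * ?G (y, w, Z \<omega>) \<partial>lborel_vec {..<m}) =
      (\<integral>\<^sup>+y. ennreal (joint (Suc m) y w (Z \<omega>)) * F (y, w, Z \<omega>) \<partial>lborel_vec {..<Suc m})" ..
  qed
  finally show ?case .
qed

lemma sigma_finite_vec_L: "sigma_finite_measure (lborel_vec {..<m} \<Otimes>\<^sub>M L)"
proof -
  interpret Y: sigma_finite_measure "lborel_vec {..<m}" by (rule lborel_prod.sigma_finite) simp
  interpret YL: pair_sigma_finite "lborel_vec {..<m}" L ..
  show ?thesis by (rule YL.sigma_finite_measure_axioms)
qed

lemma nn_integral_vec_L:
  assumes "F \<in> borel_measurable (lborel_vec {..<m} \<Otimes>\<^sub>M L)"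
  shows "(\<integral>\<^sup>+p. F p \<partial>(lborel_vec {..<m} \<Otimes>\<^sub>M L)) = (\<integral>\<^sup>+w. (\<integral>\<^sup>+y. F (y, w) \<partial>lborel_vec {..<m}) \<partial>L)"
proof -
  interpret Y: sigma_finite_measure "lborel_vec {..<m}" by (rule lborel_prod.sigma_finite) simp
  interpret pair_sigma_finite "lborel_vec {..<m}" L ..
  show ?thesis using assms by (rule nn_integral_snd[symmetric])
qed

text \<open>The pair with \<open>V\<close> is used because its conditional density is real-valued everywhere;
  integrating \<open>w\<close> out could produce infinite values.\<close>
lemma cond_density_joint:
  "cond_density M (lborel_vec {..<n} \<Otimes>\<^sub>M L) (\<lambda>\<omega>. (\<lambda>i\<in>{..<n}. U i \<omega>, V \<omega>)) K Z
    (\<lambda>(y, w) x. g w * joint n y w x)"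
proof (rule cond_densityI)
  interpret Y: sigma_finite_measure "lborel_vec {..<n}" by (rule lborel_prod.sigma_finite) simp
  note [measurable] = U_vec_measurable[OF order_refl] g_real_measurable
  show "(\<lambda>\<omega>. (\<lambda>i\<in>{..<n}. U i \<omega>, V \<omega>)) \<in> measurable M (lborel_vec {..<n} \<Otimes>\<^sub>M L)"
    by measurable
  show "Z \<in> measurable M K" by measurable
  have "(\<lambda>p. g (snd (fst p)) * joint n (fst (fst p)) (snd (fst p)) (snd p))
      \<in> borel_measurable ((lborel_vec {..<n} \<Otimes>\<^sub>M L) \<Otimes>\<^sub>M K)"
    by measurable
  then show joint_meas[measurable]: "(\<lambda>(y, z). (case y of (y, w) \<Rightarrow> \<lambda>x. g w * joint n y w x) z)
      \<in> borel_measurable ((lborel_vec {..<n} \<Otimes>\<^sub>M L) \<Otimes>\<^sub>M K)"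
    by (simp add: case_prod_beta')
  show "sigma_finite_measure (lborel_vec {..<n} \<Otimes>\<^sub>M L)"
    by (rule sigma_finite_vec_L)
  show "0 \<le> (case y of (y, w) \<Rightarrow> \<lambda>x. g w * joint n y w x) x"
    if "y \<in> space (lborel_vec {..<n} \<Otimes>\<^sub>M L)" "x \<in> space K" for y x
    using that by (auto simp: space_pair_measure intro!: mult_nonneg_nonneg g_nonneg joint_nonneg)
  \<comment> \<open>Used twice: with \<open>F\<close> constantly 1 for the total mass, and with the
    section of a test function at \<open>Z \<omega>\<close> for the disintegration.\<close>
  have integral: "(\<integral>\<^sup>+p. ennreal ((case p of (y, w) \<Rightarrow> \<lambda>x. g w * joint n y w x) x) * F p \<partial>(lborel_vec {..<n} \<Otimes>\<^sub>M L)) =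
      (\<integral>\<^sup>+w. ennreal (g w) * (\<integral>\<^sup>+y. ennreal (joint n y w x) * F (y, w) \<partial>lborel_vec {..<n}) \<partial>L)"
    if [measurable]: "F \<in> borel_measurable (lborel_vec {..<n} \<Otimes>\<^sub>M L)" "x \<in> space K" for F x
  proof -
    have "(\<integral>\<^sup>+p. ennreal ((case p of (y, w) \<Rightarrow> \<lambda>x. g w * joint n y w x) x) * F p \<partial>(lborel_vec {..<n} \<Otimes>\<^sub>M L)) =
      (\<integral>\<^sup>+w. (\<integral>\<^sup>+y. ennreal (g w * joint n y w x) * F (y, w) \<partial>lborel_vec {..<n}) \<partial>L)"
      by (subst nn_integral_vec_L) simp_all
    also have "\<dots> = (\<integral>\<^sup>+w. (\<integral>\<^sup>+y. ennreal (g w) * (ennreal (joint n y w x) * F (y, w)) \<partial>lborel_vec {..<n}) \<partial>L)"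
      using that by (intro nn_integral_cong)
        (simp add: ennreal_mult g_nonneg joint_nonneg mult.assoc)
    also have "\<dots> = (\<integral>\<^sup>+w. ennreal (g w) * (\<integral>\<^sup>+y. ennreal (joint n y w x) * F (y, w) \<partial>lborel_vec {..<n}) \<partial>L)"
      by (intro nn_integral_cong nn_integral_cmult) measurable
    finally show ?thesis .
  qed
  show "(\<integral>\<^sup>+p. ennreal ((case p of (y, w) \<Rightarrow> \<lambda>x. g w * joint n y w x) x) \<partial>(lborel_vec {..<n} \<Otimes>\<^sub>M L)) = 1"
    if x: "x \<in> space K" for x
  proof -
    have "(\<integral>\<^sup>+w. ennreal (g w) * (\<integral>\<^sup>+y. ennreal (joint n y w x) \<partial>lborel_vec {..<n}) \<partial>L) = (\<integral>\<^sup>+w. ennreal (g w) \<partial>L)"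
      using x by (intro nn_integral_cong) (simp add: nn_integral_joint)
    with integral[of "\<lambda>_. 1", OF _ x] show ?thesis by (simp add: g_prob)
  qed
  fix F' :: "((nat \<Rightarrow> real) \<times> 'b) \<times> 'c \<Rightarrow> ennreal"
  assume F'[measurable]: "F' \<in> borel_measurable ((lborel_vec {..<n} \<Otimes>\<^sub>M L) \<Otimes>\<^sub>M K)"
  have "(\<integral>\<^sup>+\<omega>. F' ((\<lambda>i\<in>{..<n}. U i \<omega>, V \<omega>), Z \<omega>) \<partial>M) =
      (\<integral>\<^sup>+\<omega>. (\<integral>\<^sup>+w. ennreal (g w) *
        (\<integral>\<^sup>+y. ennreal (joint n y w (Z \<omega>)) * F' ((y, w), Z \<omega>) \<partial>lborel_vec {..<n}) \<partial>L) \<partial>M)"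
    using nn_integral_U_V_Z[of n "\<lambda>(y, w, x). F' ((y, w), x)"] by simp
  also have "\<dots> = (\<integral>\<^sup>+\<omega>. (\<integral>\<^sup>+p. ennreal ((case p of (y, w) \<Rightarrow> \<lambda>x. g w * joint n y w x) (Z \<omega>)) * F' (p, Z \<omega>)
      \<partial>(lborel_vec {..<n} \<Otimes>\<^sub>M L)) \<partial>M)"
    by (intro nn_integral_cong integral[symmetric]) simp_all
  finally show "(\<integral>\<^sup>+\<omega>. F' ((\<lambda>i\<in>{..<n}. U i \<omega>, V \<omega>), Z \<omega>) \<partial>M) =
      (\<integral>\<^sup>+\<omega>. (\<integral>\<^sup>+p. ennreal ((case p of (y, w) \<Rightarrow> \<lambda>x. g w * joint n y w x) (Z \<omega>)) * F' (p, Z \<omega>)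
      \<partial>(lborel_vec {..<n} \<Otimes>\<^sub>M L)) \<partial>M)" .
qed

text \<open>Telescoping by induction on \<open>m\<close>: replacing \<open>x\<close> by
  \<open>x0\<close> in one factor at a time, the factors before it have total mass 1 at
  \<open>x0\<close> and the factors after it have total mass 1 at \<open>x\<close>. What remains is
  the one-step distance, bounded by its supremum over histories.\<close>

lemma nn_integral_joint_diff_le:
  assumes "m \<le> n" and x[measurable]: "x \<in> space K" and x0[measurable]: "x0 \<in> space K"
  shows "(\<integral>\<^sup>+w. ennreal (g w) * (\<integral>\<^sup>+y. ennreal \<bar>joint m y w x - joint m y w x0\<bar> \<partial>lborel_vec {..<m}) \<partial>L)
    \<le> (\<Sum>s<m. \<integral>\<^sup>+w. ennreal (g w) * (SUP y\<in>space (lborel_vec {..<s}).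
          \<integral>\<^sup>+v. ennreal \<bar>h s v y w x - h s v y w x0\<bar> \<partial>lborel) \<partial>L)"
  using assms(1)
proof (induction m)
  case 0
  then show ?case by (simp add: joint_def)
next
  case (Suc m)
  then have m: "m < n" by simp
  let ?J = "\<lambda>m w. \<integral>\<^sup>+y. ennreal \<bar>joint m y w x - joint m y w x0\<bar> \<partial>lborel_vec {..<m}"
  let ?d = "\<lambda>y w. \<integral>\<^sup>+v. ennreal \<bar>h m v y w x - h m v y w x0\<bar> \<partial>lborel"
  let ?T = "\<lambda>w. \<integral>\<^sup>+y. ennreal (joint m y w x0) * ?d y w \<partial>lborel_vec {..<m}"
  interpret Y: sigma_finite_measure "lborel_vec {..<m}" by (rule lborel_prod.sigma_finite) simp
  have J_Suc: "?J (Suc m) w \<le> ?J m w + ?T w" if w[measurable]: "w \<in> space L" for w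
  proof -
    have "?J (Suc m) w =
      (\<integral>\<^sup>+y. (\<integral>\<^sup>+v. ennreal \<bar>joint (Suc m) (y(m := v)) w x - joint (Suc m) (y(m := v)) w x0\<bar> \<partial>lborel) \<partial>lborel_vec {..<m})"
      using m by (intro nn_integral_lborel_vec_Suc) measurable
    also have "\<dots> \<le> (\<integral>\<^sup>+y. ennreal \<bar>joint m y w x - joint m y w x0\<bar> + ennreal (joint m y w x0) * ?d y w \<partial>lborel_vec {..<m})"
    proof (rule nn_integral_mono)
      fix y assume y[measurable]: "y \<in> space (lborel_vec {..<m})"
      have "(\<integral>\<^sup>+v. ennreal \<bar>joint (Suc m) (y(m := v)) w x - joint (Suc m) (y(m := v)) w x0\<bar> \<partial>lborel)
        \<le> (\<integral>\<^sup>+v. ennreal \<bar>joint m y w x - joint m y w x0\<bar> * ennreal (h m v y w x)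
            + ennreal (joint m y w x0) * ennreal \<bar>h m v y w x - h m v y w x0\<bar> \<partial>lborel)"
      proof (rule nn_integral_mono)
        fix v
        let ?a = "joint m y w x" and ?c = "joint m y w x0" and ?b = "h m v y w x" and ?e = "h m v y w x0"
        have nn: "0 \<le> ?c" "0 \<le> ?b"
          using m w x x0 y by (simp_all add: joint_nonneg h_nonneg)
        \<comment> \<open>The new factor at \<open>x\<close> multiplies the old difference and
          integrates to 1 over \<open>v\<close>; the old product at \<open>x0\<close> multiplies the
          new difference. Both multipliers are nonnegative, so they leave the absolute
          values.\<close>
        have "?a * ?b - ?c * ?e = (?a - ?c) * ?b + ?c * (?b - ?e)" by (simp add: algebra_simps)
        then have "\<bar>?a * ?b - ?c * ?e\<bar> \<le> \<bar>?a - ?c\<bar> * ?b + ?c * \<bar>?b - ?e\<bar>"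
          using abs_triangle_ineq[of "(?a - ?c) * ?b" "?c * (?b - ?e)"] nn by (simp add: abs_mult)
        then have "ennreal \<bar>?a * ?b - ?c * ?e\<bar> \<le> ennreal (\<bar>?a - ?c\<bar> * ?b + ?c * \<bar>?b - ?e\<bar>)"
          by (rule ennreal_leI)
        also have "\<dots> = ennreal \<bar>?a - ?c\<bar> * ennreal ?b + ennreal ?c * ennreal \<bar>?b - ?e\<bar>"
          using nn by (simp add: ennreal_mult)
        finally show "ennreal \<bar>joint (Suc m) (y(m := v)) w x - joint (Suc m) (y(m := v)) w x0\<bar> \<le> \<dots>"
          using y by (simp only: joint_Suc)
      qed
      also have "\<dots> = ennreal \<bar>joint m y w x - joint m y w x0\<bar> * (\<integral>\<^sup>+v. ennreal (h m v y w x) \<partial>lborel)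
          + ennreal (joint m y w x0) * ?d y w"
        using m by (simp add: nn_integral_add nn_integral_cmult)
      finally show "(\<integral>\<^sup>+v. ennreal \<bar>joint (Suc m) (y(m := v)) w x - joint (Suc m) (y(m := v)) w x0\<bar> \<partial>lborel)
        \<le> ennreal \<bar>joint m y w x - joint m y w x0\<bar> + ennreal (joint m y w x0) * ?d y w"
        using m w x y by (simp add: h_prob)
    qed
    also have "\<dots> = ?J m w + ?T w"
      using m by (intro nn_integral_add) measurable
    finally show ?thesis .
  qed
  \<comment> \<open>The supremum need not be measurable in \<open>w\<close>, and the lower integral is only superadditive, so
    the supremum may be inserted only after the integral over \<open>w\<close> has been split.\<close>
  have T: "?T w \<le> (SUP y\<in>space (lborel_vec {..<m}). ?d y w)" if w[measurable]: "w \<in> space L" for w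
  proof -
    have "?T w \<le> (\<integral>\<^sup>+y. ennreal (joint m y w x0) * (SUP y\<in>space (lborel_vec {..<m}). ?d y w) \<partial>lborel_vec {..<m})"
      by (intro nn_integral_mono mult_left_mono SUP_upper) simp_all
    \<comment> \<open>For fixed \<open>w\<close> the supremum is constant in \<open>y\<close>, and
      \<open>joint m\<close> at \<open>x0\<close> has mass 1.\<close>
    also have "\<dots> = (SUP y\<in>space (lborel_vec {..<m}). ?d y w)"
      using m w x0 by (subst nn_integral_multc) (simp_all add: nn_integral_joint)
    finally show ?thesis .
  qed
  have "(\<integral>\<^sup>+w. ennreal (g w) * ?J (Suc m) w \<partial>L) \<le> (\<integral>\<^sup>+w. ennreal (g w) * ?J m w + ennreal (g w) * ?T w \<partial>L)"
    unfolding distrib_left[symmetric] by (intro nn_integral_mono mult_left_mono J_Suc) simp_all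
  also have "\<dots> = (\<integral>\<^sup>+w. ennreal (g w) * ?J m w \<partial>L) + (\<integral>\<^sup>+w. ennreal (g w) * ?T w \<partial>L)"
    using m by (intro nn_integral_add) measurable
  also have "\<dots> \<le> (\<Sum>s<m. \<integral>\<^sup>+w. ennreal (g w) * (SUP y\<in>space (lborel_vec {..<s}).
          \<integral>\<^sup>+v. ennreal \<bar>h s v y w x - h s v y w x0\<bar> \<partial>lborel) \<partial>L)
      + (\<integral>\<^sup>+w. ennreal (g w) * (SUP y\<in>space (lborel_vec {..<m}). ?d y w) \<partial>L)"
    using m by (intro add_mono Suc.IH nn_integral_mono mult_left_mono T) simp_all
  finally show ?case by simp
qed

text \<open>Both densities carry the same factor \<open>g\<close>, because the law of
  \<open>V\<close> does not change with \<open>x\<close>; it comes out of the difference as a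
  weight.\<close>

lemma nn_integral_joint_density_diff_le:
  assumes x[measurable]: "x \<in> space K" and x0[measurable]: "x0 \<in> space K"
  shows "(\<integral>\<^sup>+p. ennreal \<bar>(case p of (y, w) \<Rightarrow> \<lambda>x. g w * joint n y w x) x -
        (case p of (y, w) \<Rightarrow> \<lambda>x. g w * joint n y w x) x0\<bar> \<partial>(lborel_vec {..<n} \<Otimes>\<^sub>M L))
    \<le> (\<Sum>s<n. \<integral>\<^sup>+w. ennreal (g w) * (SUP y\<in>space (lborel_vec {..<s}).
          \<integral>\<^sup>+v. ennreal \<bar>h s v y w x - h s v y w x0\<bar> \<partial>lborel) \<partial>L)"
proof -
  note [measurable] = g_real_measurable
  have "(\<integral>\<^sup>+p. ennreal \<bar>(case p of (y, w) \<Rightarrow> \<lambda>x. g w * joint n y w x) x -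
        (case p of (y, w) \<Rightarrow> \<lambda>x. g w * joint n y w x) x0\<bar> \<partial>(lborel_vec {..<n} \<Otimes>\<^sub>M L)) =
      (\<integral>\<^sup>+w. (\<integral>\<^sup>+y. ennreal \<bar>g w * joint n y w x - g w * joint n y w x0\<bar> \<partial>lborel_vec {..<n}) \<partial>L)"
    by (subst nn_integral_vec_L) (simp_all add: case_prod_beta')
  also have "\<dots> = (\<integral>\<^sup>+w. (\<integral>\<^sup>+y. ennreal (g w) * ennreal \<bar>joint n y w x - joint n y w x0\<bar> \<partial>lborel_vec {..<n}) \<partial>L)"
    by (intro nn_integral_cong)
      (simp add: right_diff_distrib[symmetric] abs_mult ennreal_mult g_nonneg)
  also have "\<dots> = (\<integral>\<^sup>+w. ennreal (g w) * (\<integral>\<^sup>+y. ennreal \<bar>joint n y w x - joint n y w x0\<bar> \<partial>lborel_vec {..<n}) \<partial>L)"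
    by (intro nn_integral_cong nn_integral_cmult) measurable
  also note nn_integral_joint_diff_le[OF order_refl x x0]
  finally show ?thesis .
qed

end

section \<open>The box and the past and future events of the process\<close>

lemma eta_box_sets: "eta_box r \<eta> \<in> sets (lborel_vec {..r})"
proof -
  have "eta_box r \<eta> = {\<nu> \<in> space (lborel_vec {..r}). \<forall>j\<in>{..r}. \<bar>\<nu> j\<bar> \<le> \<eta> j}"
    by (auto simp: eta_box_def space_PiM)
  also have "\<dots> \<in> sets (lborel_vec {..r})"
    by measurable
  finally show ?thesis .
qed

lemma events_of_past_subset:
  assumes "past_vec X t r \<in> measurable M (lborel_vec {..r})"
  shows "events_of M X {t - int r..t} \<subseteq> {past_vec X t r -` A \<inter> space M | A. A \<in> sets (lborel_vec {..r})}"
  using assms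
proof (rule events_of_subset_vimage)
  fix i assume i: "i \<in> {t - int r..t}"
  then have "(\<lambda>\<nu>. \<nu> (nat (t - i))) \<in> measurable (lborel_vec {..r}) lborel"
    by (intro measurable_component_singleton) auto
  with i show "\<exists>\<phi>\<in>borel_measurable (lborel_vec {..r}). \<forall>\<omega>\<in>space M. X i \<omega> = \<phi> (past_vec X t r \<omega>)"
    by (intro bexI[of _ "\<lambda>\<nu>. \<nu> (nat (t - i))"]) (auto simp: past_vec_def)
qed

text \<open>The map \<open>p\<close> reads the future vector off \<open>V\<close>: it is the
  identity when \<open>V\<close> is that vector and \<open>fst\<close> when \<open>V\<close> is its
  pair with \<open>W\<close>. In the second case the future events are only some of the events of
  \<open>V\<close>, and an inclusion is all that the bounds require.\<close>

lemma events_of_future_subset: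
  assumes V: "V \<in> measurable M K" and p: "p \<in> measurable K (lborel_vec {..r})"
    and pV: "\<And>\<omega>. \<omega> \<in> space M \<Longrightarrow> p (V \<omega>) = fut_vec X t {..r} \<omega>"
  shows "events_of M X {t..t + int r} \<subseteq> {V -` B \<inter> space M | B. B \<in> sets K}"
  using V
proof (rule events_of_subset_vimage)
  fix i assume i: "i \<in> {t..t + int r}"
  then have "(\<lambda>\<nu>. \<nu> (nat (i - t))) \<in> measurable (lborel_vec {..r}) lborel"
    by (intro measurable_component_singleton) auto
  with p have "(\<lambda>v. p v (nat (i - t))) \<in> measurable K lborel"
    by (rule measurable_compose)
  with i pV show "\<exists>\<phi>\<in>borel_measurable K. \<forall>\<omega>\<in>space M. X i \<omega> = \<phi> (V \<omega>)"
    by (intro bexI[of _ "\<lambda>v. p v (nat (i - t))"]) (auto simp: fut_vec_def)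
qed

theorem proposition2p1:
  fixes M :: "'a measure"
    and X :: "int \<Rightarrow> 'a \<Rightarrow> real"
    and t :: int and k r1 r2 :: nat
    and \<eta> :: "nat \<Rightarrow> real"
    and f :: "(nat \<Rightarrow> real) \<Rightarrow> (nat \<Rightarrow> real) \<Rightarrow> real"
  defines "\<F> \<equiv> events_of M X {t - int r1..t}"
    and "\<G> \<equiv> events_of M X {t + int k..t + int k + int r2}"
    and "E \<equiv> {\<omega> \<in> space M. past_vec X t r1 \<omega> \<in> eta_box r1 \<eta>}"
  assumes "prob_space M"
    and "\<And>i. X i \<in> borel_measurable M"
    and "k \<ge> 1"
    and "\<And>j. j \<le> r1 \<Longrightarrow> 0 \<le> \<eta> j"
    and "cond_density M (lborel_vec {..r2}) (fut_vec X (t + int k) {..r2})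
           (lborel_vec {..r1}) (past_vec X t r1) f"
  shows
    "sup_events M \<F> \<G>
       \<le> 2 * (SUP x\<in>eta_box r1 \<eta>.
                 \<integral>\<^sup>+y. ennreal \<bar>f y x - f y (zero_vec r1)\<bar> \<partial>lborel_vec {..r2})
          + 4 * emeasure M (space M - E) \<and>
     sup_partitions M \<F> \<G>
       \<le> 2 * (\<integral>\<^sup>+y. (SUP x\<in>eta_box r1 \<eta>. ennreal \<bar>f y x - f y (zero_vec r1)\<bar>)
                 \<partial>lborel_vec {..r2})
          + 4 * emeasure M (space M - E) \<and>
     (\<forall>(W :: int \<Rightarrow> 'a \<Rightarrow> real) (fW :: (nat \<Rightarrow> real) \<Rightarrow> real)
        (fs :: nat \<Rightarrow> real \<Rightarrow> (nat \<Rightarrow> real) \<Rightarrow> (nat \<Rightarrow> real) \<Rightarrow> (nat \<Rightarrow> real) \<Rightarrow> real).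
        (\<forall>w\<in>space (lborel_vec {1..<k}). 0 \<le> fW w) \<and>
        distributed M (lborel_vec {1..<k}) (fut_vec W t {1..<k}) (\<lambda>w. ennreal (fW w)) \<and>
        prob_space.indep_var M (lborel_vec {1..<k}) (fut_vec W t {1..<k})
          (lborel_vec {..r1}) (past_vec X t r1) \<and>
        (\<forall>s\<le>r2. cond_density M lborel (X (t + int k + int s))
           (lborel_vec {..<s} \<Otimes>\<^sub>M lborel_vec {1..<k} \<Otimes>\<^sub>M lborel_vec {..r1})
           (\<lambda>\<omega>. (fut_vec X (t + int k) {..<s} \<omega>, fut_vec W t {1..<k} \<omega>, past_vec X t r1 \<omega>))
           (\<lambda>ys (y, w, x). fs s ys y w x))
        \<longrightarrow>
        sup_events M \<F> \<G>
          \<le> 2 * (\<Sum>s\<le>r2. SUP x\<in>eta_box r1 \<eta>.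
                    \<integral>\<^sup>+w. ennreal (fW w) *
                       (SUP y\<in>space (lborel_vec {..<s}).
                          \<integral>\<^sup>+ys. ennreal \<bar>fs s ys y w x - fs s ys y w (zero_vec r1)\<bar> \<partial>lborel)
                    \<partial>lborel_vec {1..<k})
             + 4 * emeasure M (space M - E) \<and>
        sup_partitions M \<F> \<G>
          \<le> 2 * (\<Sum>s\<le>r2.
                    \<integral>\<^sup>+w. ennreal (fW w) *
                       (SUP y\<in>space (lborel_vec {..<s}).
                          \<integral>\<^sup>+ys. (SUP x\<in>eta_box r1 \<eta>.
                                     ennreal \<bar>fs s ys y w x - fs s ys y w (zero_vec r1)\<bar>) \<partial>lborel)
                    \<partial>lborel_vec {1..<k})
             + 4 * emeasure M (space M - E))"
proof -
  interpret prob_space M by fact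
  let ?K = "lborel_vec {..r1}" and ?Z = "past_vec X t r1" and ?E = "eta_box r1 \<eta>" and ?zero = "zero_vec r1"
  note cd = assms(8)
  have Z[measurable]: "?Z \<in> measurable M ?K" by (rule cond_density_measurable(2)[OF cd])
  have z0: "?zero \<in> space ?K" by (simp add: space_PiM)
  have box_space: "x \<in> space ?K" if "x \<in> ?E" for x
    using sets.sets_into_space[OF eta_box_sets] that by blast
  have past: "\<F> \<subseteq> {?Z -` A \<inter> space M | A. A \<in> sets ?K}"
    unfolding \<F>_def by (rule events_of_past_subset[OF Z])
  have lv: "sigma_finite_measure (lborel_vec I)" if "finite I" for I
    using that by (rule lborel_prod.sigma_finite)

  interpret f: cond_density_space M "lborel_vec {..r2}" "fut_vec X (t + int k) {..r2}" ?K ?Z f ?zero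
    by (intro cond_density_space.intro prob_space_axioms lv cond_density_space_axioms.intro cd z0) simp
  have fut: "\<G> \<subseteq> {fut_vec X (t + int k) {..r2} -` B \<inter> space M | B. B \<in> sets (lborel_vec {..r2})}"
    unfolding \<G>_def
    by (rule events_of_future_subset[OF cond_density_measurable(1)[OF cd], where p = "\<lambda>y. y"]) auto
  have 1: "sup_events M \<F> \<G>
       \<le> 2 * (SUP x\<in>?E. \<integral>\<^sup>+y. ennreal \<bar>f y x - f y ?zero\<bar> \<partial>lborel_vec {..r2})
          + 4 * emeasure M (space M - E)"
    unfolding E_def by (rule f.sup_events_le[OF eta_box_sets past fut])
  have "sup_partitions M \<F> \<G>
       \<le> 2 * (SUP x\<in>?E. \<integral>\<^sup>+y. ennreal \<bar>f y x - f y ?zero\<bar> \<partial>lborel_vec {..r2})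
          + 4 * emeasure M (space M - E)"
    unfolding E_def by (rule f.sup_partitions_le[OF eta_box_sets past fut])
  \<comment> \<open>Moving the supremum inside only enlarges the bound. Monotonicity suffices, so a
    non-measurable supremum under the lower integral does no harm.\<close>
  also have "\<dots> \<le> 2 * (\<integral>\<^sup>+y. (SUP x\<in>?E. ennreal \<bar>f y x - f y ?zero\<bar>) \<partial>lborel_vec {..r2})
          + 4 * emeasure M (space M - E)"
    by (intro add_right_mono mult_left_mono SUP_least nn_integral_mono SUP_upper) simp_all
  finally have 2: "sup_partitions M \<F> \<G>
       \<le> 2 * (\<integral>\<^sup>+y. (SUP x\<in>?E. ennreal \<bar>f y x - f y ?zero\<bar>) \<partial>lborel_vec {..r2})
          + 4 * emeasure M (space M - E)" .

  have "sup_events M \<F> \<G>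
          \<le> 2 * (\<Sum>s\<le>r2. SUP x\<in>?E.
                    \<integral>\<^sup>+w. ennreal (fW w) *
                       (SUP y\<in>space (lborel_vec {..<s}).
                          \<integral>\<^sup>+ys. ennreal \<bar>fs s ys y w x - fs s ys y w ?zero\<bar> \<partial>lborel)
                    \<partial>lborel_vec {1..<k})
             + 4 * emeasure M (space M - E)" (is "_ \<le> 2 * ?Bev + _")
    and "sup_partitions M \<F> \<G>
          \<le> 2 * (\<Sum>s\<le>r2.
                    \<integral>\<^sup>+w. ennreal (fW w) *
                       (SUP y\<in>space (lborel_vec {..<s}).
                          \<integral>\<^sup>+ys. (SUP x\<in>?E.
                                     ennreal \<bar>fs s ys y w x - fs s ys y w ?zero\<bar>) \<partial>lborel)
                    \<partial>lborel_vec {1..<k})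
             + 4 * emeasure M (space M - E)" (is "_ \<le> 2 * ?Bpart + _")
    if fW: "\<forall>w\<in>space (lborel_vec {1..<k}). 0 \<le> fW w"
      and W: "distributed M (lborel_vec {1..<k}) (fut_vec W t {1..<k}) (\<lambda>w. ennreal (fW w))"
      and indep: "indep_var (lborel_vec {1..<k}) (fut_vec W t {1..<k}) ?K ?Z"
      and fs: "\<forall>s\<le>r2. cond_density M lborel (X (t + int k + int s))
           (lborel_vec {..<s} \<Otimes>\<^sub>M lborel_vec {1..<k} \<Otimes>\<^sub>M ?K)
           (\<lambda>\<omega>. (fut_vec X (t + int k) {..<s} \<omega>, fut_vec W t {1..<k} \<omega>, ?Z \<omega>))
           (\<lambda>ys (y, w, x). fs s ys y w x)"
    for W :: "int \<Rightarrow> 'a \<Rightarrow> real" and fW :: "(nat \<Rightarrow> real) \<Rightarrow> real"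
      and fs :: "nat \<Rightarrow> real \<Rightarrow> (nat \<Rightarrow> real) \<Rightarrow> (nat \<Rightarrow> real) \<Rightarrow> (nat \<Rightarrow> real) \<Rightarrow> real"
  proof -
    \<comment> \<open>There are \<open>Suc r2\<close> future coordinates, numbered from 0 to
      \<open>r2\<close>. For \<open>k = 1\<close> the index set \<open>{1..<k}\<close> is empty and
      \<open>?V\<close> takes its values in a one-point space, so that case needs no separate
      argument.\<close>
    let ?L = "lborel_vec {1..<k}" and ?V = "fut_vec W t {1..<k}" and ?n = "Suc r2"
    let ?Y = "\<lambda>\<omega>. (fut_vec X (t + int k) {..<?n} \<omega>, ?V \<omega>)"
    interpret L: sigma_finite_measure ?L by (rule lv) simp
    interpret c: chained_density M ?L ?V ?K ?Z "\<lambda>s. X (t + int k + int s)" fW fs ?n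
      using fW W indep fs
      by unfold_locales (auto simp: indep_var_distribution_eq fut_vec_def)
    let ?h = "\<lambda>(y, w) x. fW w * c.joint ?n y w x"
    have cd_h: "cond_density M (lborel_vec {..<?n} \<Otimes>\<^sub>M ?L) ?Y ?K ?Z ?h"
      using c.cond_density_joint by (simp add: fut_vec_def)
    interpret h: cond_density_space M "lborel_vec {..<?n} \<Otimes>\<^sub>M ?L" ?Y ?K ?Z ?h ?zero
      by (intro cond_density_space.intro prob_space_axioms c.sigma_finite_vec_L cond_density_space_axioms.intro cd_h z0)
    \<comment> \<open>Future events are events of the pair that ignore its second component.\<close>
    have fut': "\<G> \<subseteq> {?Y -` B \<inter> space M | B. B \<in> sets (lborel_vec {..<?n} \<Otimes>\<^sub>M ?L)}"
      unfolding \<G>_def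
      by (rule events_of_future_subset[OF cond_density_measurable(1)[OF cd_h], where p = fst])
        (simp_all add: lessThan_Suc_atMost)
    let ?D = "\<lambda>s x. \<integral>\<^sup>+w. ennreal (fW w) * (SUP y\<in>space (lborel_vec {..<s}).
        \<integral>\<^sup>+ys. ennreal \<bar>fs s ys y w x - fs s ys y w ?zero\<bar> \<partial>lborel) \<partial>?L"
    have h_le: "(\<integral>\<^sup>+p. ennreal \<bar>?h p x - ?h p ?zero\<bar> \<partial>(lborel_vec {..<?n} \<Otimes>\<^sub>M ?L)) \<le> (\<Sum>s\<le>r2. ?D s x)"
      if "x \<in> ?E" for x
    proof -
      note x = box_space[OF that]
      show ?thesis
        using c.nn_integral_joint_density_diff_le[OF x z0] by (simp only: lessThan_Suc_atMost)
    qed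
    have "sup_events M \<F> \<G> \<le>
        2 * (SUP x\<in>?E. \<integral>\<^sup>+p. ennreal \<bar>?h p x - ?h p ?zero\<bar> \<partial>(lborel_vec {..<?n} \<Otimes>\<^sub>M ?L)) + 4 * emeasure M (space M - E)"
      unfolding E_def by (rule h.sup_events_le[OF eta_box_sets past fut'])
    also have "\<dots> \<le> 2 * ?Bev + 4 * emeasure M (space M - E)"
    proof (intro add_right_mono mult_left_mono SUP_least)
      \<comment> \<open>At fixed \<open>x\<close> each summand is at most its own supremum over the
        box, so the supremum of the sum is at most the sum of the suprema.\<close>
      fix x assume x: "x \<in> ?E"
      show "(\<integral>\<^sup>+p. ennreal \<bar>?h p x - ?h p ?zero\<bar> \<partial>(lborel_vec {..<?n} \<Otimes>\<^sub>M ?L)) \<le> ?Bev"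
        by (intro order_trans[OF h_le[OF x]] sum_mono SUP_upper x)
    qed simp
    finally show "sup_events M \<F> \<G> \<le> 2 * ?Bev + 4 * emeasure M (space M - E)" .
    have "sup_partitions M \<F> \<G> \<le>
        2 * (SUP x\<in>?E. \<integral>\<^sup>+p. ennreal \<bar>?h p x - ?h p ?zero\<bar> \<partial>(lborel_vec {..<?n} \<Otimes>\<^sub>M ?L)) + 4 * emeasure M (space M - E)"
      unfolding E_def by (rule h.sup_partitions_le[OF eta_box_sets past fut'])
    also have "\<dots> \<le> 2 * ?Bpart + 4 * emeasure M (space M - E)"
    proof (intro add_right_mono mult_left_mono SUP_least)
      \<comment> \<open>At fixed \<open>x\<close> the supremum over the box is inserted under the
        innermost integral over \<open>ys\<close>; the suprema over histories and the integrals over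
        \<open>w\<close> are then compared by monotonicity.\<close>
      fix x assume x: "x \<in> ?E"
      show "(\<integral>\<^sup>+p. ennreal \<bar>?h p x - ?h p ?zero\<bar> \<partial>(lborel_vec {..<?n} \<Otimes>\<^sub>M ?L)) \<le> ?Bpart"
        by (intro order_trans[OF h_le[OF x]] sum_mono nn_integral_mono mult_left_mono SUP_mono' SUP_upper x)
          (rule zero_le)
    qed simp
    finally show "sup_partitions M \<F> \<G> \<le> 2 * ?Bpart + 4 * emeasure M (space M - E)" .
  qed
  with 1 2 show ?thesis by blast
qed

end
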